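(* Let $X$ be an effective topological space with standard representation $\rho_X$. The following are equivalent: (1) $X$ is an effective quasi-Polish space; (2) the image $e[X]$ of $X$ under its canonical embedding $e$ is a computably overt $\Pi^0_2$-subset of $\mathcal{P}(\omega)$; (3) $\mathrm{dom}(\rho_X)$ is a computably overt $\Pi^0_2$-subset of $\mathbb{N}^{\mathbb{N}}$.
   Context: Let $(W_e)$ be a standard enumeration of c.e. sets. An effective topological space is a countably based $T_0$ space $X$ with a numbering $(B_i)_{i\in\mathbb{N}}$ of a basis such that for some computable $f$, $B_i\cap B_j=\bigcup_{k\in W_{f(i,j)}}B_k$. Effective open sets are $\bigcup_{i\in W}B_i$, $W$ c.e.; uniformly effective open means with computably given indices. $\Sigma^0_2$ sets are $\bigcup_n(U_n\setminus V_n)$ with $U_n,V_n$ uniformly effective open; $\Pi^0_2$ sets are their complements. A set $A$ is computably overt if $\{i:B_i\cap A\neq\emptyset\}$ is c.e. The Baire space $\mathbb{N}^{\mathbb{N}}$ has basis the cylinders $[\sigma]$; $\mathcal{P}(\omega)$ has the Scott topology with basis $\{Y: F\subseteq Y\}$, $F$ finite. A map $f:X\to Y$ between effective topological spaces is computable if $f^{-1}(B^Y_i)$ are uniformly effective open; a map $f:\mathbb{N}^{\mathbb{N}}\to X$ is effectively open if there are uniformly effective open $U_\sigma\subseteq X$ with $f([\sigma])=U_\sigma$ for all $\sigma\in\mathbb{N}^*$. $X$ is an effective quasi-Polish space if $X$ is empty or $X$ is the image of $\mathbb{N}^{\mathbb{N}}$ under a computable effectively open map. The canonical embedding is $e(x)=\{n:x\in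 B_n\}$. With $\rho(p)=\{n:\exists i\,p(i)=n+1\}$, the standard representation $\rho_X$ has domain $\rho^{-1}(e[X])$ and $\rho_X(p)=e^{-1}(\rho(p))$. *)

theory Defs
  imports "HOL-Analysis.Analysis" "HOL-Library.Nat_Bijection"
begin

section \<open>Partial recursive functions and c.e. sets\<close>

text \<open>
  Programs for the unary partial recursive functions; functions of several arguments go through
  the Cantor pairing \<^const>\<open>prod_encode\<close>. \<open>Prec f g\<close> is primitive recursion with base case \<open>f\<close> and
  step \<open>g\<close>, \<open>Mu f\<close> is unbounded minimization.
\<close>

datatype prog =
    Zero
  | Succ
  | Fst
  | Snd
  | Pairing prog prog
  | Comp prog prog
  | Prec prog prog
  | Mu prog

inductive evaluates :: "prog \<Rightarrow> nat \<Rightarrow> nat \<Rightarrow> bool" where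
  Zero: "evaluates Zero x 0"
| Succ: "evaluates Succ x (Suc x)"
| Fst: "evaluates Fst (prod_encode (a, b)) a"
| Snd: "evaluates Snd (prod_encode (a, b)) b"
| Pairing: "evaluates f x a \<Longrightarrow> evaluates g x b \<Longrightarrow> evaluates (Pairing f g) x (prod_encode (a, b))"
| Comp: "evaluates g x a \<Longrightarrow> evaluates f a y \<Longrightarrow> evaluates (Comp f g) x y"
| Prec_0: "evaluates f a y \<Longrightarrow> evaluates (Prec f g) (prod_encode (a, 0)) y"
| Prec_Suc: "evaluates (Prec f g) (prod_encode (a, n)) z \<Longrightarrow>
    evaluates g (prod_encode (a, prod_encode (n, z))) y \<Longrightarrow>
    evaluates (Prec f g) (prod_encode (a, Suc n)) y"
| Mu: "evaluates f (prod_encode (a, m)) 0 \<Longrightarrow>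
    (\<forall>k<m. \<exists>z. evaluates f (prod_encode (a, k)) (Suc z)) \<Longrightarrow>
    evaluates (Mu f) a m"

inductive_cases evaluates_elims:
  "evaluates Zero x y" "evaluates Succ x y" "evaluates Fst x y" "evaluates Snd x y"
  "evaluates (Pairing f g) x y" "evaluates (Comp f g) x y" "evaluates (Prec f g) x y"
  "evaluates (Mu f) x y"

lemma evaluates_functional: "evaluates p x y \<Longrightarrow> evaluates p x y' \<Longrightarrow> y = y'"
proof (induction arbitrary: y' rule: evaluates.induct)
  case (Pairing f x a g b)
  from Pairing.prems obtain a' b' where "evaluates f x a'" "evaluates g x b'" "y' = prod_encode (a', b')"
    by (auto elim: evaluates_elims)
  then show ?case using Pairing.IH by metis
next
  case (Comp g x a f y)
  from Comp.prems obtain a' where "evaluates g x a'" "evaluates f a' y'"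
    by (auto elim: evaluates_elims)
  then show ?case using Comp.IH by metis
next
  case (Prec_0 f a y g)
  from Prec_0.prems have "evaluates f a y'" by (cases rule: evaluates.cases) auto
  then show ?case by (rule Prec_0.IH)
next
  case (Prec_Suc f g a n z y)
  from Prec_Suc.prems obtain z' where "evaluates (Prec f g) (prod_encode (a, n)) z'"
    "evaluates g (prod_encode (a, prod_encode (n, z'))) y'"
    by (cases rule: evaluates.cases) auto
  then show ?case using Prec_Suc.IH by metis
next
  case (Mu f a m)
  from Mu.prems have m': "evaluates f (prod_encode (a, y')) 0"
    "\<forall>k<y'. \<exists>z. evaluates f (prod_encode (a, k)) (Suc z)"
    by (auto elim: evaluates_elims)
  show ?case
  proof (rule linorder_cases[of m y'])
    assume "m < y'" then show ?thesis using m' Mu.IH(1) by blast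
  next
    assume "y' < m" then show ?thesis using m' Mu.IH(2) by blast
  qed
qed (erule evaluates_elims; simp)+

definition computable :: "(nat \<Rightarrow> nat) \<Rightarrow> bool" where
  "computable f \<longleftrightarrow> (\<exists>p. \<forall>x. evaluates p x (f x))"

fun prog_code :: "prog \<Rightarrow> nat" where
  "prog_code Zero = 0"
| "prog_code Succ = 1"
| "prog_code Fst = 2"
| "prog_code Snd = 3"
| "prog_code (Pairing f g) = 4 + 4 * prod_encode (prog_code f, prog_code g)"
| "prog_code (Comp f g) = 5 + 4 * prod_encode (prog_code f, prog_code g)"
| "prog_code (Prec f g) = 6 + 4 * prod_encode (prog_code f, prog_code g)"
| "prog_code (Mu f) = 7 + 4 * prog_code f"

lemma inj_prog_code: "prog_code p = prog_code q \<Longrightarrow> p = q"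
proof (induction p arbitrary: q)
  case Zero then show ?case by (cases q) auto
next
  case Succ then show ?case by (cases q) auto
next
  case Fst then show ?case by (cases q) auto
next
  case Snd then show ?case by (cases q) auto
next
  case (Pairing f g) from Pairing.prems show ?case by (cases q) (auto dest: Pairing.IH | presburger)+
next
  case (Comp f g) from Comp.prems show ?case by (cases q) (auto dest: Comp.IH | presburger)+
next
  case (Prec f g) from Prec.prems show ?case by (cases q) (auto dest: Prec.IH | presburger)+
next
  case (Mu f) from Mu.prems show ?case by (cases q) (auto dest: Mu.IH | presburger)+
qed

lemma surj_prog_code: "\<exists>p. prog_code p = n"
proof (induction n rule: less_induct)
  case (less n)
  show ?case
  proof (cases "n < 4")
    case True
    then have "n = 0 \<or> n = 1 \<or> n = 2 \<or> n = 3" by auto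
    then show ?thesis by (metis prog_code.simps(1-4))
  next
    case False
    define m where "m = (n - 4) div 4"
    obtain a b where ab: "m = prod_encode (a, b)"
      by (metis prod_decode_inverse surj_pair)
    have "a \<le> m" "b \<le> m" by (simp_all add: ab le_prod_encode_1 le_prod_encode_2)
    moreover have "m < n" using False by (simp add: m_def)
    ultimately have "a < n" "b < n" "m < n" by simp_all
    then obtain p q r where "prog_code p = a" "prog_code q = b" "prog_code r = m"
      using less.IH by metis
    then have codes: "prog_code (Pairing p q) = 4 + 4 * m" "prog_code (Comp p q) = 5 + 4 * m"
      "prog_code (Prec p q) = 6 + 4 * m" "prog_code (Mu r) = 7 + 4 * m"
      by (simp_all add: ab)
    have "n = 4 + 4 * m \<or> n = 5 + 4 * m \<or> n = 6 + 4 * m \<or> n = 7 + 4 * m"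
      using False unfolding m_def by presburger
    then show ?thesis using codes by metis
  qed
qed

theorem bij_prog_code: "bij prog_code"
  using inj_prog_code surj_prog_code by (metis bijI injI surjI)

definition W :: "nat \<Rightarrow> nat set" where
  "W e = {x. \<exists>p y. prog_code p = e \<and> evaluates p x y}"

definition ce :: "nat set \<Rightarrow> bool" where
  "ce A \<longleftrightarrow> (\<exists>e. A = W e)"


section \<open>Effective topological spaces\<close>

definition effective_topological_space :: "'a topology \<Rightarrow> (nat \<Rightarrow> 'a set) \<Rightarrow> bool" where
  "effective_topological_space X B \<longleftrightarrow>
     t0_space X \<and>
     openin X = arbitrary union_of (\<lambda>U. U \<in> range B) \<and>
     (\<exists>f. computable f \<and> (\<forall>i j. B i \<inter> B j = (\<Union>k\<in>W (f (prod_encode (i, j))). B k)))"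

definition effective_open :: "(nat \<Rightarrow> 'a set) \<Rightarrow> 'a set \<Rightarrow> bool" where
  "effective_open B U \<longleftrightarrow> (\<exists>A. ce A \<and> U = (\<Union>i\<in>A. B i))"

definition uniformly_effective_open :: "(nat \<Rightarrow> 'a set) \<Rightarrow> (nat \<Rightarrow> 'a set) \<Rightarrow> bool" where
  "uniformly_effective_open B U \<longleftrightarrow>
     (\<exists>f. computable f \<and> (\<forall>n. U n = (\<Union>i\<in>W (f n). B i)))"

definition Sigma02 :: "(nat \<Rightarrow> 'a set) \<Rightarrow> 'a set \<Rightarrow> bool" where
  "Sigma02 B A \<longleftrightarrow>
     (\<exists>U V. uniformly_effective_open B U \<and> uniformly_effective_open B V \<and> A = (\<Union>n. U n - V n))"

definition Pi02 :: "'a topology \<Rightarrow> (nat \<Rightarrow> 'a set) \<Rightarrow> 'a set \<Rightarrow> bool" where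
  "Pi02 X B A \<longleftrightarrow> A \<subseteq> topspace X \<and> Sigma02 B (topspace X - A)"

definition computably_overt :: "(nat \<Rightarrow> 'a set) \<Rightarrow> 'a set \<Rightarrow> bool" where
  "computably_overt B A \<longleftrightarrow> ce {i. B i \<inter> A \<noteq> {}}"

definition computable_map ::
    "'a topology \<Rightarrow> (nat \<Rightarrow> 'a set) \<Rightarrow> 'b topology \<Rightarrow> (nat \<Rightarrow> 'b set) \<Rightarrow> ('a \<Rightarrow> 'b) \<Rightarrow> bool" where
  "computable_map X B Y C f \<longleftrightarrow>
     f \<in> topspace X \<rightarrow> topspace Y \<and>
     uniformly_effective_open B (\<lambda>i. {x \<in> topspace X. f x \<in> C i})"


section \<open>The Baire space and \<open>\<P>(\<omega>)\<close>\<close>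

definition Baire :: "(nat \<Rightarrow> nat) topology" where
  "Baire = product_topology (\<lambda>_. discrete_topology UNIV) UNIV"

definition cylinder :: "nat list \<Rightarrow> (nat \<Rightarrow> nat) set" where
  "cylinder \<sigma> = {p. \<forall>k<length \<sigma>. p k = \<sigma> ! k}"

definition Baire_basis :: "nat \<Rightarrow> (nat \<Rightarrow> nat) set" where
  "Baire_basis i = cylinder (list_decode i)"

text \<open>\<^const>\<open>set_decode\<close> is the canonical numbering of the finite sets of naturals.\<close>

definition Pomega_basis :: "nat \<Rightarrow> nat set set" where
  "Pomega_basis i = {Y. set_decode i \<subseteq> Y}"

definition Pomega :: "nat set topology" where
  "Pomega = topology_generated_by (range Pomega_basis)"

lemma topspace_Baire [simp]: "topspace Baire = UNIV"
  by (simp add: Baire_def)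

lemma range_Baire_basis: "range Baire_basis = range cylinder"
proof -
  have "Baire_basis = cylinder \<circ> list_decode" by (auto simp: Baire_basis_def)
  then show ?thesis by (metis image_comp surj_list_decode)
qed

lemma openin_Baire: "openin Baire = arbitrary union_of (\<lambda>U. U \<in> range Baire_basis)"
  unfolding openin_topology_base_unique range_Baire_basis
proof (intro conjI allI impI)
  fix V assume "V \<in> range cylinder"
  then obtain \<sigma> where V: "V = cylinder \<sigma>" by auto
  have "V = (\<Pi>\<^sub>E k\<in>UNIV. if k < length \<sigma> then {\<sigma> ! k} else UNIV)"
    unfolding V cylinder_def by (auto simp: PiE_iff split: if_splits)
  moreover have "finite {k. (if k < length \<sigma> then {\<sigma> ! k} else (UNIV :: nat set)) \<noteq> UNIV}"
    by (rule finite_subset[of _ "{..<length \<sigma>}"]) auto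
  ultimately show "openin Baire V"
    unfolding Baire_def by (simp add: openin_PiE_gen)
next
  fix U p assume "openin Baire U \<and> p \<in> U"
  then obtain S where S: "finite {k. S k \<noteq> (UNIV :: nat set)}" "p \<in> Pi\<^sub>E UNIV S" "Pi\<^sub>E UNIV S \<subseteq> U"
    unfolding Baire_def openin_product_topology_alt by auto
  obtain n where n: "\<And>k. S k \<noteq> UNIV \<Longrightarrow> k < n"
    using finite_nat_bounded[OF S(1)] by auto
  have "p \<in> cylinder (map p [0..<n])" by (simp add: cylinder_def)
  moreover have "cylinder (map p [0..<n]) \<subseteq> U"
  proof
    fix q assume "q \<in> cylinder (map p [0..<n])"
    then have "q k = p k" if "k < n" for k using that by (simp add: cylinder_def)
    moreover have "p k \<in> S k" for k using S(2) by (simp add: PiE_iff)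
    ultimately have "q k \<in> S k" for k using n by (metis UNIV_I)
    then show "q \<in> U" using S(3) by (auto simp: PiE_iff)
  qed
  ultimately show "\<exists>B. B \<in> range cylinder \<and> p \<in> B \<and> B \<subseteq> U" by blast
qed

lemma topspace_Pomega [simp]: "topspace Pomega = UNIV"
proof -
  have "Pomega_basis 0 = UNIV" by (simp add: Pomega_basis_def)
  then have "\<Union>(range Pomega_basis) = UNIV" by blast
  then show ?thesis by (simp add: Pomega_def)
qed

lemma range_Pomega_basis: "range Pomega_basis = {{Y. F \<subseteq> Y} | F. finite F}"
proof (intro equalityI subsetI)
  fix V :: "nat set set" assume "V \<in> {{Y. F \<subseteq> Y} | F. finite F}"
  then obtain F where F: "finite F" "V = {Y. F \<subseteq> Y}" by blast
  then have "V = Pomega_basis (set_encode F)" by (simp add: Pomega_basis_def)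
  then show "V \<in> range Pomega_basis" by blast
next
  fix V assume "V \<in> range Pomega_basis"
  then obtain i where "V = Pomega_basis i" by blast
  then have "V = {Y. set_decode i \<subseteq> Y} \<and> finite (set_decode i)"
    by (simp add: Pomega_basis_def)
  then show "V \<in> {{Y. F \<subseteq> Y} | F. finite F}" by blast
qed

lemma openin_Pomega: "openin Pomega = arbitrary union_of (\<lambda>U. U \<in> range Pomega_basis)"
  unfolding openin_topology_base_unique
proof (intro conjI allI impI)
  fix V assume "V \<in> range Pomega_basis"
  then show "openin Pomega V" unfolding Pomega_def by (rule topology_generated_by_Basis)
next
  fix U Y assume "openin Pomega U \<and> Y \<in> U"
  then have "generate_topology_on (range Pomega_basis) U" "Y \<in> U"
    unfolding Pomega_def by (auto simp: openin_topology_generated_by_iff)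
  then show "\<exists>B. B \<in> range Pomega_basis \<and> Y \<in> B \<and> B \<subseteq> U"
  proof (induction rule: generate_topology_on.induct)
    case (Int a b)
    then obtain V V' where V: "V \<in> range Pomega_basis" "Y \<in> V" "V \<subseteq> a"
      and V': "V' \<in> range Pomega_basis" "Y \<in> V'" "V' \<subseteq> b" by blast
    obtain F G where FG: "finite F" "V = {Y. F \<subseteq> Y}" "finite G" "V' = {Y. G \<subseteq> Y}"
      using V(1) V'(1) unfolding range_Pomega_basis by blast
    have "V \<inter> V' = {Y. F \<union> G \<subseteq> Y}" using FG by auto
    then have "V \<inter> V' \<in> range Pomega_basis"
      unfolding range_Pomega_basis using FG by blast
    then show ?case using V V' by (intro exI[of _ "V \<inter> V'"]) blast
  next
    case (UN K)
    then obtain k where "k \<in> K" "Y \<in> k" by blast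
    then show ?case using UN.IH by (meson Sup_upper order_trans)
  qed auto
qed

text \<open>The topology of \<^const>\<open>Pomega\<close> is the Scott topology of the inclusion order.\<close>

lemma openin_Pomega_iff_Scott:
  "openin Pomega U \<longleftrightarrow>
     (\<forall>Y Z. Y \<in> U \<and> Y \<subseteq> Z \<longrightarrow> Z \<in> U) \<and>
     (\<forall>D. D \<noteq> {} \<and> (\<forall>Y\<in>D. \<forall>Z\<in>D. \<exists>V\<in>D. Y \<union> Z \<subseteq> V) \<and> \<Union>D \<in> U \<longrightarrow> D \<inter> U \<noteq> {})"
    (is "_ \<longleftrightarrow> ?up \<and> ?dir")
proof
  assume "openin Pomega U"
  then have *: "\<exists>F. finite F \<and> F \<subseteq> Y \<and> {Z. F \<subseteq> Z} \<subseteq> U" if "Y \<in> U" for Y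
  proof -
    obtain V where V: "V \<in> range Pomega_basis" "Y \<in> V" "V \<subseteq> U"
      using openin_Pomega \<open>Y \<in> U\<close> \<open>openin Pomega U\<close> unfolding openin_topology_base_unique by metis
    then show ?thesis unfolding range_Pomega_basis by blast
  qed
  have ?up
  proof (intro allI impI, elim conjE)
    fix Y Z assume "Y \<in> U" "Y \<subseteq> Z"
    with *[of Y] show "Z \<in> U" by blast
  qed
  moreover have ?dir
  proof (intro allI impI, elim conjE)
    fix D :: "nat set set"
    assume D: "D \<noteq> {}" "\<forall>Y\<in>D. \<forall>Z\<in>D. \<exists>V\<in>D. Y \<union> Z \<subseteq> V" "\<Union>D \<in> U"
    obtain F where F: "finite F" "F \<subseteq> \<Union>D" "{Z. F \<subseteq> Z} \<subseteq> U" using *[OF D(3)] by blast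
    from F(1,2) have "\<exists>V\<in>D. F \<subseteq> V"
    proof (induction F rule: finite_induct)
      case empty then show ?case using D(1) by blast
    next
      case (insert x F)
      from insert obtain V where V: "V \<in> D" "F \<subseteq> V" by auto
      from insert.prems obtain Z where Z: "Z \<in> D" "x \<in> Z" by auto
      from D(2) V(1) Z(1) obtain V' where "V' \<in> D" "V \<union> Z \<subseteq> V'" by meson
      with V(2) Z(2) show ?case by (intro bexI[of _ V']) auto
    qed
    then show "D \<inter> U \<noteq> {}" using F(3) by blast
  qed
  ultimately show "?up \<and> ?dir" ..
next
  assume R: "?up \<and> ?dir"
  show "openin Pomega U"
  proof (subst openin_subopen, intro ballI)
    fix Y assume Y: "Y \<in> U"
    let ?D = "{F. finite F \<and> F \<subseteq> Y}"
    have "y \<in> \<Union>?D" if "y \<in> Y" for y using that by (intro UnionI[of "{y}"]) auto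
    then have "\<Union>?D = Y" by blast
    moreover have "?D \<noteq> {}" by blast
    moreover have "\<forall>A\<in>?D. \<forall>Z\<in>?D. \<exists>V\<in>?D. A \<union> Z \<subseteq> V"
    proof (intro ballI)
      fix A Z assume "A \<in> ?D" "Z \<in> ?D"
      then show "\<exists>V\<in>?D. A \<union> Z \<subseteq> V" by (intro bexI[of _ "A \<union> Z"]) auto
    qed
    ultimately have "?D \<inter> U \<noteq> {}" using R Y by simp
    then obtain F where F: "finite F" "F \<subseteq> Y" "F \<in> U" by blast
    have "openin Pomega {Z. F \<subseteq> Z}"
      unfolding Pomega_def
      by (rule topology_generated_by_Basis) (use F(1) range_Pomega_basis in blast)
    moreover have "{Z. F \<subseteq> Z} \<subseteq> U" using R F(3) by blast
    ultimately show "\<exists>T. openin Pomega T \<and> Y \<in> T \<and> T \<subseteq> U" using F(2) by blast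
  qed
qed


section \<open>Effective quasi-Polish spaces and the standard representation\<close>

definition effectively_open_map :: "(nat \<Rightarrow> 'a set) \<Rightarrow> ((nat \<Rightarrow> nat) \<Rightarrow> 'a) \<Rightarrow> bool" where
  "effectively_open_map B f \<longleftrightarrow>
     (\<exists>U. uniformly_effective_open B U \<and> (\<forall>\<sigma>. f ` cylinder \<sigma> = U (list_encode \<sigma>)))"

definition effective_quasi_Polish :: "'a topology \<Rightarrow> (nat \<Rightarrow> 'a set) \<Rightarrow> bool" where
  "effective_quasi_Polish X B \<longleftrightarrow>
     topspace X = {} \<or>
     (\<exists>f. computable_map Baire Baire_basis X B f \<and> effectively_open_map B f \<and>
          f ` topspace Baire = topspace X)"

definition canonical_embedding :: "(nat \<Rightarrow> 'a set) \<Rightarrow> 'a \<Rightarrow> nat set" where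
  "canonical_embedding B x = {n. x \<in> B n}"

definition \<rho> :: "(nat \<Rightarrow> nat) \<Rightarrow> nat set" where
  "\<rho> p = {n. \<exists>i. p i = n + 1}"

definition standard_representation ::
    "'a topology \<Rightarrow> (nat \<Rightarrow> 'a set) \<Rightarrow> (nat \<Rightarrow> nat) \<rightharpoonup> 'a" where
  "standard_representation X B p =
     (if \<rho> p \<in> canonical_embedding B ` topspace X
      then Some (the_inv_into (topspace X) (canonical_embedding B) (\<rho> p))
      else None)"

end

theory Submission
  imports Defs
begin

text \<open>
  The equivalence of (2) and (3) holds for every \<open>E \<subseteq> \<P>(\<omega>)\<close> and its preimage \<open>\<rho>\<^sup>-\<^sup>1(E)\<close>. Overtness and
  the implication from (2) to (3) follow because \<open>\<rho>\<close> is computable and every word compatible with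
  \<open>Y\<close> extends to a \<open>\<rho>\<close>-name of \<open>Y\<close>. Conversely, if \<open>\<rho>\<^sup>-\<^sup>1(E)\<close> is the intersection of the sets
  \<open>-U\<^sub>n \<union> V\<^sub>n\<close>, then \<open>Y \<in> E\<close> iff every word that is compatible with \<open>Y\<close> and forces \<open>U\<^sub>n\<close> has a compatible
  extension forcing \<open>V\<^sub>n\<close>: under this condition a generic name of \<open>Y\<close> lies in \<open>\<rho>\<^sup>-\<^sup>1(E)\<close>.

  From (1) to (2): if \<open>f\<close> is a computable effectively open surjection, call \<open>\<sigma>\<close> alive for \<open>Y\<close> when \<open>Y\<close>
  contains the index of some basic set from the enumeration of \<open>f[\<sigma>]\<close>. Then \<open>Y \<in> e[X]\<close> iff the empty
  word is alive, every alive \<open>\<sigma>\<close> has for each \<open>n \<in> Y\<close> a longer alive extension forcing \<open>f(p) \<in> B\<^sub>n\<close>, and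
  an alive \<open>\<sigma>\<close> forces \<open>f(p) \<in> B\<^sub>n\<close> only for \<open>n \<in> Y\<close>.

  From (2) to (1): the input enumerates increasing finite sets that are extendible within \<open>e[X]\<close>
  (a c.e. property by overtness) and that enter \<open>V\<^sub>n\<close> after having been seen in \<open>U\<^sub>n\<close>. Their union is in
  \<open>e[X]\<close>, and the inputs starting with \<open>\<sigma>\<close> produce exactly the points of a finite intersection of
  basic sets.
\<close>

section \<open>Computable functions\<close>

definition pfst :: "nat \<Rightarrow> nat" where "pfst x = fst (prod_decode x)"
definition psnd :: "nat \<Rightarrow> nat" where "psnd x = snd (prod_decode x)"

lemma pfst_prod_encode [simp]: "pfst (prod_encode (a, b)) = a"
  and psnd_prod_encode [simp]: "psnd (prod_encode (a, b)) = b"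
  and prod_encode_pfst_psnd [simp]: "prod_encode (pfst x, psnd x) = x"
  by (simp_all add: pfst_def psnd_def)

lemma computable_id: "computable (\<lambda>x. x)"
proof -
  have "evaluates (Pairing Fst Snd) (prod_encode (pfst x, psnd x)) (prod_encode (pfst x, psnd x))" for x
    by (intro evaluates.intros)
  then show ?thesis unfolding computable_def by auto
qed

lemma computable_comp:
  assumes "computable f" "computable g"
  shows "computable (\<lambda>x. f (g x))"
  using assms unfolding computable_def by (metis evaluates.Comp)

lemma computable_zero: "computable (\<lambda>x. 0)"
  unfolding computable_def using evaluates.Zero by blast

lemma computable_Suc: "computable f \<Longrightarrow> computable (\<lambda>x. Suc (f x))"
  by (rule computable_comp[of Suc]) (use evaluates.Succ in \<open>auto simp: computable_def\<close>)

lemma computable_const: "computable (\<lambda>x. c)"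
  by (induction c) (auto intro: computable_zero computable_Suc)

lemma computable_pfst: "computable f \<Longrightarrow> computable (\<lambda>x. pfst (f x))"
proof (rule computable_comp[of pfst])
  have "evaluates Fst (prod_encode (pfst x, psnd x)) (pfst x)" for x by (rule evaluates.Fst)
  then show "computable pfst" unfolding computable_def by auto
qed

lemma computable_psnd: "computable f \<Longrightarrow> computable (\<lambda>x. psnd (f x))"
proof (rule computable_comp[of psnd])
  have "evaluates Snd (prod_encode (pfst x, psnd x)) (psnd x)" for x by (rule evaluates.Snd)
  then show "computable psnd" unfolding computable_def by auto
qed

lemma computable_prod_encode:
  "computable f \<Longrightarrow> computable g \<Longrightarrow> computable (\<lambda>x. prod_encode (f x, g x))"
  unfolding computable_def by (metis evaluates.Pairing)

text \<open>\<open>Prec\<close> takes parameter and counter as one pair, so the recursion is proved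
  for every counter and then evaluated at \<open>n x\<close>. The step hypothesis uses the nesting
  of pairs that \<open>Prec\<close> feeds to its second program.\<close>

lemma computable_rec_nat:
  assumes a: "computable a" and n: "computable n"
    and s: "computable (\<lambda>z. s (pfst z) (pfst (psnd z)) (psnd (psnd z)))"
  shows "computable (\<lambda>x. rec_nat (a x) (\<lambda>k r. s x k r) (n x))"
proof -
  from a obtain p where p: "\<And>x. evaluates p x (a x)" unfolding computable_def by blast
  from s obtain q where q: "\<And>z. evaluates q z (s (pfst z) (pfst (psnd z)) (psnd (psnd z)))"
    unfolding computable_def by blast
  have "evaluates (Prec p q) (prod_encode (x, k)) (rec_nat (a x) (\<lambda>k r. s x k r) k)" for x k
  proof (induction k)
    case 0 show ?case using evaluates.Prec_0[OF p] by simp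
  next
    case (Suc k)
    have "evaluates q (prod_encode (x, prod_encode (k, z))) (s x k z)" for z
      using q[of "prod_encode (x, prod_encode (k, z))"] by simp
    from evaluates.Prec_Suc[OF Suc this] show ?case by simp
  qed
  then have "evaluates (Prec p q) z (rec_nat (a (pfst z)) (\<lambda>k r. s (pfst z) k r) (psnd z))" for z
    by (metis prod_encode_pfst_psnd)
  then have "computable (\<lambda>z. rec_nat (a (pfst z)) (\<lambda>k r. s (pfst z) k r) (psnd z))"
    unfolding computable_def by blast
  from computable_comp[OF this computable_prod_encode[OF computable_id n]] show ?thesis by simp
qed

lemmas computable_basic = computable_id computable_const computable_Suc computable_pfst
  computable_psnd computable_prod_encode

lemma computable_if_zero:
  assumes "computable c" "computable f" "computable g"
  shows "computable (\<lambda>x. if c x = 0 then f x else g x)"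
proof -
  have "computable (\<lambda>x. rec_nat (f x) (\<lambda>k r. g x) (c x))"
    by (intro computable_rec_nat computable_basic computable_comp[OF assms(3)] assms)
  moreover have "rec_nat (f x) (\<lambda>k r. g x) (c x) = (if c x = 0 then f x else g x)" for x
    by (cases "c x") auto
  ultimately show ?thesis by simp
qed

lemma computable_add:
  assumes "computable f" "computable g" shows "computable (\<lambda>x. f x + g x)"
proof -
  have "computable (\<lambda>x. rec_nat (f x) (\<lambda>k r. Suc r) (g x))"
    by (intro computable_rec_nat computable_basic assms)
  moreover have "rec_nat a (\<lambda>k r. Suc r) b = a + b" for a b by (induction b) auto
  ultimately show ?thesis by simp
qed

lemma computable_mult:
  assumes "computable f" "computable g" shows "computable (\<lambda>x. f x * g x)"
proof -
  have "computable (\<lambda>x. rec_nat 0 (\<lambda>k r. r + f x) (g x))"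
    by (intro computable_rec_nat computable_add computable_basic computable_comp[OF assms(1)] assms)
  moreover have "rec_nat 0 (\<lambda>k r. r + a) b = a * b" for a b :: nat by (induction b) auto
  ultimately show ?thesis by simp
qed

lemma computable_pred:
  assumes "computable f" shows "computable (\<lambda>x. f x - 1)"
proof -
  have "computable (\<lambda>x. rec_nat 0 (\<lambda>k r. k) (f x))"
    by (intro computable_rec_nat computable_basic assms)
  moreover have "rec_nat 0 (\<lambda>k r. k) b = b - 1" for b by (cases b) auto
  ultimately show ?thesis by simp
qed

lemma computable_diff:
  assumes "computable f" "computable g" shows "computable (\<lambda>x. f x - g x)"
proof -
  have "computable (\<lambda>x. rec_nat (f x) (\<lambda>k r. r - 1) (g x))"
    by (intro computable_rec_nat computable_pred computable_basic assms)
  moreover have "rec_nat a (\<lambda>k r. r - 1) b = a - b" for a b :: nat by (induction b) auto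
  ultimately show ?thesis by simp
qed

lemma computable_sum:
  assumes "computable (\<lambda>z. f (pfst z) (psnd z))" "computable b"
  shows "computable (\<lambda>x. \<Sum>y<b x. f x y)"
proof -
  have f: "computable (\<lambda>x. f (u x) (v x))" if "computable u" "computable v" for u v
    using computable_comp[OF assms(1) computable_prod_encode[OF that]] by simp
  have "computable (\<lambda>x. rec_nat 0 (\<lambda>k r. r + f x k) (b x))"
    by (intro computable_rec_nat computable_add computable_basic f assms)
  moreover have "rec_nat 0 (\<lambda>k r. r + f x k) n = (\<Sum>y<n. f x y)" for x n by (induction n) auto
  ultimately show ?thesis by simp
qed

lemma computable_prod:
  assumes "computable (\<lambda>z. f (pfst z) (psnd z))" "computable b"
  shows "computable (\<lambda>x. \<Prod>y<b x. f x y)"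
proof -
  have f: "computable (\<lambda>x. f (u x) (v x))" if "computable u" "computable v" for u v
    using computable_comp[OF assms(1) computable_prod_encode[OF that]] by simp
  have "computable (\<lambda>x. rec_nat 1 (\<lambda>k r. r * f x k) (b x))"
    by (intro computable_rec_nat computable_mult computable_basic f assms)
  moreover have "rec_nat 1 (\<lambda>k r. r * f x k) n = (\<Prod>y<n. f x y)" for x n by (induction n) auto
  ultimately show ?thesis by simp
qed

subsection \<open>Codes of lists and finite sets\<close>

text \<open>\<open>list_encode (a # xs)\<close> is
  \<open>Suc (prod_encode (a, list_encode xs))\<close>, so subtracting 1 and projecting recovers
  head and tail.\<close>

definition lhd :: "nat \<Rightarrow> nat" where "lhd c = pfst (c - 1)"
definition ldrop :: "nat \<Rightarrow> nat \<Rightarrow> nat" where "ldrop i c = rec_nat c (\<lambda>_ r. psnd (r - 1)) i"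
text \<open>The length of a list never exceeds its code, so counting the nonempty tails among the
  first \<open>c\<close> ones is enough.\<close>

definition llen :: "nat \<Rightarrow> nat" where
  "llen c = rec_nat 0 (\<lambda>k r. if ldrop k c = 0 then r else Suc r) c"
definition lnth :: "nat \<Rightarrow> nat \<Rightarrow> nat" where "lnth c i = lhd (ldrop i c)"

lemma ldrop_list_encode: "ldrop i (list_encode xs) = list_encode (drop i xs)"
proof (induction i)
  case 0 show ?case by (simp add: ldrop_def)
next
  case (Suc i)
  \<comment> \<open>The empty list has code 0, so this value makes the tail of the empty list empty
    again, as \<open>drop\<close> does.\<close>
  have "psnd 0 = 0"
    using psnd_prod_encode[of 0 0] by (simp add: prod_encode_def)
  then have "psnd (list_encode ys - 1) = list_encode (tl ys)" for ys
    by (cases ys) auto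
  with Suc show ?case by (simp add: ldrop_def drop_Suc tl_drop)
qed

lemma lhd_list_encode: "xs \<noteq> [] \<Longrightarrow> lhd (list_encode xs) = hd xs"
  by (cases xs) (auto simp: lhd_def)

lemma lnth_list_encode: "i < length xs \<Longrightarrow> lnth (list_encode xs) i = xs ! i"
  by (simp add: lnth_def ldrop_list_encode lhd_list_encode hd_drop_conv_nth)

lemma length_le_list_encode: "length xs \<le> list_encode xs"
proof (induction xs)
  case (Cons a xs)
  then show ?case using le_prod_encode_2[of "list_encode xs" a] by simp
qed simp

lemma list_encode_eq_0: "list_encode xs = 0 \<longleftrightarrow> xs = []"
  by (cases xs) auto

lemma llen_list_encode: "llen (list_encode xs) = length xs"
proof -
  have "rec_nat 0 (\<lambda>k r. if ldrop k (list_encode xs) = 0 then r else Suc r) n = min n (length xs)" for n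
    by (induction n) (auto simp: ldrop_list_encode list_encode_eq_0)
  then show ?thesis using length_le_list_encode[of xs] by (simp add: llen_def)
qed

lemma computable_ldrop: "computable f \<Longrightarrow> computable g \<Longrightarrow> computable (\<lambda>x. ldrop (f x) (g x))"
  unfolding ldrop_def by (intro computable_rec_nat computable_basic computable_pred)

lemma computable_lnth: "computable f \<Longrightarrow> computable g \<Longrightarrow> computable (\<lambda>x. lnth (f x) (g x))"
  unfolding lnth_def lhd_def by (intro computable_ldrop computable_basic computable_pred)

lemma computable_llen: "computable f \<Longrightarrow> computable (\<lambda>x. llen (f x))"
  unfolding llen_def
  by (rule computable_comp[of "\<lambda>c. rec_nat 0 (\<lambda>k r. if ldrop k c = 0 then r else Suc r) c"])
    (intro computable_rec_nat computable_basic computable_if_zero computable_ldrop)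

lemmas computable_intros = computable_basic computable_add computable_mult computable_diff
  computable_pred computable_ldrop computable_lnth computable_llen computable_if_zero

lemma computable_mod2: assumes "computable f" shows "computable (\<lambda>x. f x mod 2)"
proof -
  have "computable (\<lambda>x. rec_nat 0 (\<lambda>k r. 1 - r) (f x))"
    by (intro computable_rec_nat computable_intros assms)
  moreover have "rec_nat 0 (\<lambda>k r. 1 - r) b = b mod 2" for b :: nat
    by (induction b) (auto simp: mod_Suc)
  ultimately show ?thesis by simp
qed

lemma computable_div2: assumes "computable f" shows "computable (\<lambda>x. f x div 2)"
proof -
  have "computable (\<lambda>x. rec_nat 0 (\<lambda>k r. r + k mod 2) (f x))"
    by (intro computable_rec_nat computable_mod2 computable_intros assms)
  moreover have "rec_nat 0 (\<lambda>k r. r + k mod 2) b = b div 2" for b :: nat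
    by (induction b) (simp, simp, presburger)
  ultimately show ?thesis by simp
qed

lemma computable_bit:
  assumes "computable f" "computable g"
  shows "computable (\<lambda>x. (f x div 2 ^ g x) mod 2)"
proof -
  have "computable (\<lambda>x. rec_nat (f x) (\<lambda>k r. r div 2) (g x))"
    by (intro computable_rec_nat computable_div2 computable_intros assms)
  moreover have "rec_nat a (\<lambda>k r. r div 2) b = a div 2 ^ b" for a b :: nat
    by (induction b) (auto simp flip: div_mult2_eq simp: mult.commute)
  ultimately show ?thesis by (auto intro: computable_mod2)
qed

lemma set_decode_iff: "n \<in> set_decode c \<longleftrightarrow> 1 - (c div 2 ^ n) mod 2 = 0"
  unfolding set_decode_def odd_iff_mod_2_eq_one by auto

section \<open>\<open>\<Sigma>\<^sub>1\<close> predicates\<close>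

text \<open>Semidecidability with explicit witnesses, a form that is easy to close under connectives
  and quantifiers. Several variables are packed by pairing; \<open>ce_iff_Sigma1\<close> gives the
  link to c.e. sets.\<close>

definition Sigma1 :: "(nat \<Rightarrow> bool) \<Rightarrow> bool" where
  "Sigma1 P \<longleftrightarrow> (\<exists>D. computable D \<and> (\<forall>x. P x \<longleftrightarrow> (\<exists>w. D (prod_encode (x, w)) = 0)))"

lemma Sigma1E:
  assumes "Sigma1 P"
  obtains D where "computable D" "\<And>x. P x \<longleftrightarrow> (\<exists>w. D (prod_encode (x, w)) = 0)"
  using assms unfolding Sigma1_def by blast

lemma Sigma1_subst: "Sigma1 P \<Longrightarrow> computable f \<Longrightarrow> Sigma1 (\<lambda>x. P (f x))"
proof (elim Sigma1E)
  fix D assume f: "computable f" and D: "computable D"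
    and P: "\<And>x. P x \<longleftrightarrow> (\<exists>w. D (prod_encode (x, w)) = 0)"
  have "computable (\<lambda>z. D (prod_encode (f (pfst z), psnd z)))"
    by (intro computable_comp[OF D] computable_comp[OF f] computable_intros)
  then show "Sigma1 (\<lambda>x. P (f x))"
    unfolding Sigma1_def P by (intro exI[of _ "\<lambda>z. D (prod_encode (f (pfst z), psnd z))"]) simp
qed

lemma Sigma1_subst2:
  assumes "Sigma1 (\<lambda>z. P (pfst z) (psnd z))" "computable f" "computable g"
  shows "Sigma1 (\<lambda>x. P (f x) (g x))"
  using Sigma1_subst[OF assms(1) computable_prod_encode[OF assms(2,3)]] by simp

lemma Sigma1_zero: "computable f \<Longrightarrow> Sigma1 (\<lambda>x. f x = 0)"
  unfolding Sigma1_def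
  by (intro exI[of _ "\<lambda>z. f (pfst z)"] conjI) (simp_all add: computable_comp computable_pfst computable_id)

lemma Sigma1_eq:
  assumes "computable f" "computable g" shows "Sigma1 (\<lambda>x. f x = g x)"
proof -
  have "Sigma1 (\<lambda>x. (f x - g x) + (g x - f x) = 0)"
    by (intro Sigma1_zero computable_intros assms)
  moreover have "(f x - g x) + (g x - f x) = 0 \<longleftrightarrow> f x = g x" for x by auto
  ultimately show ?thesis by simp
qed

lemma Sigma1_less:
  assumes "computable f" "computable g" shows "Sigma1 (\<lambda>x. f x < g x)"
proof -
  have "Sigma1 (\<lambda>x. Suc (f x) - g x = 0)"
    by (intro Sigma1_zero computable_intros assms)
  moreover have "Suc (f x) - g x = 0 \<longleftrightarrow> f x < g x" for x by auto
  ultimately show ?thesis by simp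
qed

lemma Sigma1_mem_set_decode:
  assumes "computable f" "computable g" shows "Sigma1 (\<lambda>x. f x \<in> set_decode (g x))"
  unfolding set_decode_iff by (intro Sigma1_zero computable_intros computable_bit assms)

lemma Sigma1_not_mem_set_decode:
  assumes "computable f" "computable g" shows "Sigma1 (\<lambda>x. f x \<notin> set_decode (g x))"
proof -
  have "Sigma1 (\<lambda>x. (g x div 2 ^ f x) mod 2 = 0)"
    by (intro Sigma1_zero computable_intros computable_bit assms)
  then show ?thesis by (simp add: set_decode_def even_iff_mod_2_eq_zero)
qed

lemma Sigma1_const: "Sigma1 (\<lambda>x. b)"
  using Sigma1_zero[OF computable_const[of "if b then 0 else 1"]] by (cases b) auto

lemma Sigma1_conj:
  assumes "Sigma1 P" "Sigma1 Q" shows "Sigma1 (\<lambda>x. P x \<and> Q x)"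
proof -
  obtain D where D: "computable D" "\<And>x. P x \<longleftrightarrow> (\<exists>w. D (prod_encode (x, w)) = 0)"
    using assms(1) by (rule Sigma1E) blast
  obtain D' where D': "computable D'" "\<And>x. Q x \<longleftrightarrow> (\<exists>w. D' (prod_encode (x, w)) = 0)"
    using assms(2) by (rule Sigma1E) blast
  let ?D = "\<lambda>z. D (prod_encode (pfst z, pfst (psnd z))) + D' (prod_encode (pfst z, psnd (psnd z)))"
  have "computable ?D"
    by (intro computable_comp[OF D(1)] computable_comp[OF D'(1)] computable_intros)
  moreover have "P x \<and> Q x \<longleftrightarrow> (\<exists>w. ?D (prod_encode (x, w)) = 0)" for x
  proof
    assume "P x \<and> Q x"
    then obtain w w' where "D (prod_encode (x, w)) = 0" "D' (prod_encode (x, w')) = 0"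
      using D(2) D'(2) by blast
    then show "\<exists>w. ?D (prod_encode (x, w)) = 0"
      by (intro exI[of _ "prod_encode (w, w')"]) simp
  qed (auto simp: D(2) D'(2))
  ultimately show ?thesis unfolding Sigma1_def by blast
qed

lemma Sigma1_disj:
  assumes "Sigma1 P" "Sigma1 Q" shows "Sigma1 (\<lambda>x. P x \<or> Q x)"
proof -
  obtain D where D: "computable D" "\<And>x. P x \<longleftrightarrow> (\<exists>w. D (prod_encode (x, w)) = 0)"
    using assms(1) by (rule Sigma1E) blast
  obtain D' where D': "computable D'" "\<And>x. Q x \<longleftrightarrow> (\<exists>w. D' (prod_encode (x, w)) = 0)"
    using assms(2) by (rule Sigma1E) blast
  have "computable (\<lambda>z. D z * D' z)"
    by (intro computable_intros D(1) D'(1))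
  then show ?thesis
    unfolding Sigma1_def D(2) D'(2) by (intro exI[of _ "\<lambda>z. D z * D' z"]) auto
qed

lemma Sigma1_ex:
  assumes "Sigma1 (\<lambda>z. P (pfst z) (psnd z))" shows "Sigma1 (\<lambda>x. \<exists>y. P x y)"
proof -
  obtain D where D: "computable D"
    "\<And>z. P (pfst z) (psnd z) \<longleftrightarrow> (\<exists>w. D (prod_encode (z, w)) = 0)"
    using assms by (rule Sigma1E) blast
  have P: "P x y \<longleftrightarrow> (\<exists>w. D (prod_encode (prod_encode (x, y), w)) = 0)" for x y
    using D(2)[of "prod_encode (x, y)"] by simp
  let ?D = "\<lambda>z. D (prod_encode (prod_encode (pfst z, pfst (psnd z)), psnd (psnd z)))"
  have "computable ?D"
    by (intro computable_comp[OF D(1)] computable_intros)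
  moreover have "(\<exists>y. P x y) \<longleftrightarrow> (\<exists>w. ?D (prod_encode (x, w)) = 0)" for x
    unfolding P by (metis pfst_prod_encode psnd_prod_encode)
  ultimately show ?thesis unfolding Sigma1_def by blast
qed

text \<open>Finitely many witnesses have a common bound \<open>w\<close>, which replaces them: the
  sum over \<open>y\<close> of the products over \<open>v < w\<close> vanishes iff every
  \<open>y\<close> has a witness below \<open>w\<close>.\<close>

lemma Sigma1_all_less:
  assumes "Sigma1 (\<lambda>z. P (pfst z) (psnd z))" "computable b"
  shows "Sigma1 (\<lambda>x. \<forall>y<b x. P x y)"
proof -
  obtain D where D: "computable D"
    "\<And>z. P (pfst z) (psnd z) \<longleftrightarrow> (\<exists>w. D (prod_encode (z, w)) = 0)"
    using assms(1) by (rule Sigma1E) blast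
  have P: "P x y \<longleftrightarrow> (\<exists>w. D (prod_encode (prod_encode (x, y), w)) = 0)" for x y
    using D(2)[of "prod_encode (x, y)"] by simp
  let ?D = "\<lambda>z. \<Sum>y<b (pfst z). \<Prod>v<psnd z. D (prod_encode (prod_encode (pfst z, y), v))"
  have "computable ?D"
    by (intro computable_sum computable_prod computable_comp[OF D(1)] computable_comp[OF assms(2)]
        computable_intros)
  moreover have "(\<forall>y<b x. P x y) \<longleftrightarrow> (\<exists>w. ?D (prod_encode (x, w)) = 0)" for x
  proof
    assume "\<forall>y<b x. P x y"
    then have "\<forall>y. \<exists>v. y < b x \<longrightarrow> D (prod_encode (prod_encode (x, y), v)) = 0"
      unfolding P by blast
    then obtain v where v: "\<And>y. y < b x \<Longrightarrow> D (prod_encode (prod_encode (x, y), v y)) = 0"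
      by metis
    obtain w where "\<And>y. y < b x \<Longrightarrow> v y < w"
      using finite_nat_bounded[of "v ` {..<b x}"] by auto
    then show "\<exists>w. ?D (prod_encode (x, w)) = 0"
      using v by (intro exI[of _ w]) auto
  qed (auto simp: P)
  ultimately show ?thesis unfolding Sigma1_def by blast
qed

lemmas Sigma1_intros = Sigma1_const Sigma1_eq Sigma1_less Sigma1_mem_set_decode
  Sigma1_not_mem_set_decode Sigma1_conj Sigma1_disj Sigma1_ex Sigma1_all_less

text \<open>Since \<open>D\<close> is total, minimization over the witness halts exactly when a zero
  exists.\<close>

lemma Sigma1_imp_domain:
  assumes "Sigma1 P"
  obtains p where "\<And>x. P x \<longleftrightarrow> (\<exists>y. evaluates p x y)"
proof -
  obtain D where D: "computable D" "\<And>x. P x \<longleftrightarrow> (\<exists>w. D (prod_encode (x, w)) = 0)"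
    using assms by (rule Sigma1E) blast
  from D(1) obtain q where q: "\<And>z. evaluates q z (D z)" unfolding computable_def by blast
  have "P x \<longleftrightarrow> (\<exists>y. evaluates (Mu q) x y)" for x
  proof
    assume "P x"
    then have ex: "\<exists>w. D (prod_encode (x, w)) = 0" using D(2) by blast
    let ?m = "LEAST w. D (prod_encode (x, w)) = 0"
    have "D (prod_encode (x, ?m)) = 0" using ex by (rule LeastI_ex)
    moreover have "\<exists>z. D (prod_encode (x, k)) = Suc z" if "k < ?m" for k
      using not_less_Least[OF that] by (cases "D (prod_encode (x, k))") auto
    ultimately have "evaluates (Mu q) x ?m" by (metis evaluates.Mu q)
    then show "\<exists>y. evaluates (Mu q) x y" ..
  next
    assume "\<exists>y. evaluates (Mu q) x y"
    then obtain m where "evaluates q (prod_encode (x, m)) 0" by (auto elim: evaluates_elims)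
    then have "D (prod_encode (x, m)) = 0" using q evaluates_functional by metis
    then show "P x" using D(2) by blast
  qed
  then show ?thesis by (rule that)
qed

section \<open>A universal \<open>\<Sigma>\<^sub>1\<close> relation\<close>

definition prog_of :: "nat \<Rightarrow> prog" where "prog_of = inv prog_code"

lemma prog_of_code [simp]: "prog_of (prog_code p) = p"
  by (simp add: prog_of_def bij_is_inj bij_prog_code)

lemma prog_code_of [simp]: "prog_code (prog_of e) = e"
  by (simp add: prog_of_def bij_is_surj bij_prog_code surj_f_inv_f)

lemma mem_W_iff: "x \<in> W e \<longleftrightarrow> (\<exists>y. evaluates (prog_of e) x y)"
  unfolding W_def by (auto, metis prog_code_of)

abbreviation trip :: "nat \<Rightarrow> nat \<Rightarrow> nat \<Rightarrow> nat" where
  "trip e x y \<equiv> prod_encode (e, prod_encode (x, y))"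

text \<open>\<open>justified S e x y\<close>: the judgement \<open>evaluates (prog_of e) x y\<close> follows by one rule from the
  coded judgements in \<open>S\<close>.\<close>

definition justified :: "(nat \<Rightarrow> bool) \<Rightarrow> nat \<Rightarrow> nat \<Rightarrow> nat \<Rightarrow> bool" where
  "justified S e x y \<longleftrightarrow>
     e = 0 \<and> y = 0 \<or> e = 1 \<and> y = Suc x \<or> e = 2 \<and> y = pfst x \<or> e = 3 \<and> y = psnd x \<or>
     (\<exists>f g. e = 4 + 4 * prod_encode (f, g) \<and> S (trip f x (pfst y)) \<and> S (trip g x (psnd y))) \<or>
     (\<exists>f g. e = 5 + 4 * prod_encode (f, g) \<and> (\<exists>a. S (trip g x a) \<and> S (trip f a y))) \<or>
     (\<exists>f g. e = 6 + 4 * prod_encode (f, g) \<and>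
        (psnd x = 0 \<and> S (trip f (pfst x) y) \<or>
         (\<exists>n. psnd x = Suc n \<and> (\<exists>z. S (trip e (prod_encode (pfst x, n)) z) \<and>
            S (trip g (prod_encode (pfst x, prod_encode (n, z))) y))))) \<or>
     (\<exists>f. e = 7 + 4 * f \<and> S (trip f (prod_encode (x, y)) 0) \<and>
        (\<forall>k<y. \<exists>z. S (trip f (prod_encode (x, k)) (Suc z))))"

text \<open>\<open>S\<close> occurs only positively in the rules, so a justification survives when
  more judgements become available, as in a concatenation of derivations.\<close>

lemma justified_mono:
  assumes "\<And>t. S t \<Longrightarrow> S' t" shows "justified S e x y \<longrightarrow> justified S' e x y"
  unfolding justified_def
  by (intro disj_mono ex_mono conj_mono imp_refl all_mono impI allI) (auto intro: assms)

lemma justified_sound: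
  assumes S: "\<And>e x y. S (trip e x y) \<Longrightarrow> evaluates (prog_of e) x y" and j: "justified S e x y"
  shows "evaluates (prog_of e) x y"
proof -
  have p: "prog_of 0 = Zero" "prog_of 1 = Succ" "prog_of 2 = Fst" "prog_of 3 = Snd"
    using prog_of_code[of Zero] prog_of_code[of Succ] prog_of_code[of Fst] prog_of_code[of Snd]
    by auto
  have P: "prog_of (4 + 4 * prod_encode (f, g)) = Pairing (prog_of f) (prog_of g)"
    "prog_of (5 + 4 * prod_encode (f, g)) = Comp (prog_of f) (prog_of g)"
    "prog_of (6 + 4 * prod_encode (f, g)) = Prec (prog_of f) (prog_of g)"
    "prog_of (7 + 4 * f) = Mu (prog_of f)" for f g
    using prog_of_code[of "Pairing (prog_of f) (prog_of g)"]
      prog_of_code[of "Comp (prog_of f) (prog_of g)"]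
      prog_of_code[of "Prec (prog_of f) (prog_of g)"] prog_of_code[of "Mu (prog_of f)"]
    by (simp_all only: prog_code.simps prog_code_of)
  show ?thesis using j unfolding justified_def
  proof (elim disjE exE conjE, goal_cases)
    case 1 then show ?case by (simp add: p evaluates.Zero)
  next
    case 2 then show ?case by (simp only: p evaluates.Succ)
  next
    case 3 then show ?case using evaluates.Fst[of "pfst x" "psnd x"] by (simp add: p)
  next
    case 4 then show ?case using evaluates.Snd[of "pfst x" "psnd x"] by (simp add: p)
  next
    case (5 f g)
    then show ?case using evaluates.Pairing[OF S S, of f x "pfst y" g "psnd y"] by (simp only: P) simp
  next
    case (6 f g a)
    then show ?case by (simp only: P) (blast intro: evaluates.Comp S)
  next
    case (7 f g)
    then show ?case using evaluates.Prec_0[OF S, of f "pfst x" y "prog_of g"]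
      by (simp only: P) (metis prod_encode_pfst_psnd)
  next
    case (8 f g n z)
    have "evaluates (Prec (prog_of f) (prog_of g)) (prod_encode (pfst x, n)) z"
      using S[OF 8(3)] 8(1) by (simp only: P)
    from evaluates.Prec_Suc[OF this S[OF 8(4)]] 8(1,2) show ?case
      by (simp only: P) (metis prod_encode_pfst_psnd)
  next
    case (9 f)
    then show ?case by (simp only: P) (blast intro: evaluates.Mu S)
  qed
qed

text \<open>The newest conclusion comes first: an entry may appeal only to entries behind it, which
  rules out circular justification.\<close>

fun valid_derivation :: "nat list \<Rightarrow> bool" where
  "valid_derivation [] \<longleftrightarrow> True"
| "valid_derivation (t # L) \<longleftrightarrow>
     justified (\<lambda>u. u \<in> set L) (pfst t) (pfst (psnd t)) (psnd (psnd t)) \<and> valid_derivation L"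

lemma valid_sound: "valid_derivation L \<Longrightarrow> trip e x y \<in> set L \<Longrightarrow> evaluates (prog_of e) x y"
proof (induction L arbitrary: e x y)
  case (Cons t L)
  have "evaluates (prog_of (pfst t)) (pfst (psnd t)) (psnd (psnd t))"
  proof (rule justified_sound[of "\<lambda>u. u \<in> set L"])
    show "evaluates (prog_of e) x y" if "trip e x y \<in> set L" for e x y
      using Cons.IH Cons.prems(1) that by simp
    show "justified (\<lambda>u. u \<in> set L) (pfst t) (pfst (psnd t)) (psnd (psnd t))"
      using Cons.prems(1) by simp
  qed
  then show ?case using Cons.IH Cons.prems by (cases "trip e x y = t") auto
qed simp

lemma valid_append: "valid_derivation L \<Longrightarrow> valid_derivation M \<Longrightarrow> valid_derivation (L @ M)"
  by (induction L) (auto elim!: justified_mono[THEN mp, rotated])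

lemma valid_extend:
  "valid_derivation L \<Longrightarrow> justified (\<lambda>u. u \<in> set L) e x y \<Longrightarrow> \<exists>L. valid_derivation L \<and> trip e x y \<in> set L"
  by (intro exI[of _ "trip e x y # L"]) simp

text \<open>Serves minimization, the one rule whose number of premises is not fixed: derivations of
  all of them are concatenated.\<close>

lemma valid_finite:
  assumes "\<And>k. k < (n::nat) \<Longrightarrow> \<exists>L. valid_derivation L \<and> t k \<in> set L"
  shows "\<exists>L. valid_derivation L \<and> (\<forall>k<n. t k \<in> set L)"
  using assms
proof (induction n)
  case 0
  have "valid_derivation []" by simp
  then show ?case by blast
next
  case (Suc n)
  then obtain L where L: "valid_derivation L" "\<forall>k<n. t k \<in> set L" by (meson less_SucI)
  obtain M where M: "valid_derivation M" "t n \<in> set M" using Suc.prems by blast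
  have "valid_derivation (L @ M)" using L M valid_append by blast
  moreover have "\<forall>k<Suc n. t k \<in> set (L @ M)" using L M less_Suc_eq by auto
  ultimately show ?case by blast
qed

lemma valid_two:
  assumes "\<exists>L. valid_derivation L \<and> s \<in> set L" "\<exists>L. valid_derivation L \<and> t \<in> set L"
  shows "\<exists>L. valid_derivation L \<and> s \<in> set L \<and> t \<in> set L"
proof -
  obtain L M where "valid_derivation L" "s \<in> set L" "valid_derivation M" "t \<in> set M" using assms by blast
  then show ?thesis by (intro exI[of _ "L @ M"]) (auto intro: valid_append)
qed

text \<open>By induction on the evaluation: derivations of the premises are concatenated and the
  conclusion is put in front.\<close>

lemma valid_complete:
  "evaluates p x y \<Longrightarrow> \<exists>L. valid_derivation L \<and> trip (prog_code p) x y \<in> set L"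
proof (induction rule: evaluates.induct)
  case (Zero x) show ?case by (rule valid_extend[of "[]"]) (auto simp: justified_def)
next
  case (Succ x) show ?case by (rule valid_extend[of "[]"]) (auto simp: justified_def)
next
  case (Fst a b) show ?case by (rule valid_extend[of "[]"]) (auto simp: justified_def)
next
  case (Snd a b) show ?case by (rule valid_extend[of "[]"]) (auto simp: justified_def)
next
  case (Pairing f x a g b)
  then obtain L where "valid_derivation L" "trip (prog_code f) x a \<in> set L" "trip (prog_code g) x b \<in> set L"
    using valid_two by blast
  then show ?case by (intro valid_extend[of L]) (auto simp: justified_def)
next
  case (Comp g x a f y)
  then obtain L where "valid_derivation L" "trip (prog_code g) x a \<in> set L" "trip (prog_code f) a y \<in> set L"
    using valid_two by blast
  then show ?case by (intro valid_extend[of L]) (auto simp: justified_def)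
next
  case (Prec_0 f a y g)
  then obtain L where "valid_derivation L" "trip (prog_code f) a y \<in> set L" by blast
  then show ?case by (intro valid_extend[of L]) (auto simp: justified_def)
next
  case (Prec_Suc f g a n z y)
  then obtain L where "valid_derivation L" "trip (prog_code (Prec f g)) (prod_encode (a, n)) z \<in> set L"
    "trip (prog_code g) (prod_encode (a, prod_encode (n, z))) y \<in> set L"
    using valid_two by blast
  then show ?case by (intro valid_extend[of L]) (auto simp: justified_def)
next
  case (Mu f a m)
  obtain M where M: "valid_derivation M" "trip (prog_code f) (prod_encode (a, m)) 0 \<in> set M" using Mu by blast
  obtain z where z: "\<And>k. k < m \<Longrightarrow>
      \<exists>L. valid_derivation L \<and> trip (prog_code f) (prod_encode (a, k)) (Suc (z k)) \<in> set L"
    using Mu.IH(2) by metis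
  obtain L where L: "valid_derivation L"
    "\<forall>k<m. trip (prog_code f) (prod_encode (a, k)) (Suc (z k)) \<in> set L"
    using valid_finite[of m "\<lambda>k. trip (prog_code f) (prod_encode (a, k)) (Suc (z k))"] z by blast
  show ?case
  proof (rule valid_extend)
    show "valid_derivation (L @ M)" using L M valid_append by blast
    show "justified (\<lambda>u. u \<in> set (L @ M)) (prog_code (Mu f)) a m"
      using L(2) M(2) unfolding justified_def by (intro disjI2 exI[of _ "prog_code f"]) auto
  qed
qed

definition lmem :: "nat \<Rightarrow> nat \<Rightarrow> bool" where
  "lmem t c \<longleftrightarrow> (\<exists>i. i < llen c \<and> lnth c i = t)"

lemma lmem_list_encode: "lmem t (list_encode xs) \<longleftrightarrow> t \<in> set xs"
  unfolding lmem_def llen_list_encode by (auto simp: in_set_conv_nth lnth_list_encode)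

lemma Sigma1_lmem: "computable f \<Longrightarrow> computable g \<Longrightarrow> Sigma1 (\<lambda>x. lmem (f x) (g x))"
  unfolding lmem_def
  by (rule Sigma1_subst2[where P = "\<lambda>t c. \<exists>i. i < llen c \<and> lnth c i = t"])
    (intro Sigma1_intros computable_intros)

text \<open>Turns the recursion along the list into a bounded quantifier over positions, which
  \<open>Sigma1_all_less\<close> can treat.\<close>

lemma valid_iff_nth:
  "valid_derivation L \<longleftrightarrow> (\<forall>j<length L. justified (\<lambda>u. u \<in> set (drop (Suc j) L))
     (pfst (L ! j)) (pfst (psnd (L ! j))) (psnd (psnd (L ! j))))"
  by (induction L) (auto simp: All_less_Suc2)

text \<open>The existential form of Kleene's normal form theorem: an evaluation holds iff some
  number codes a valid derivation that contains it.\<close>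

lemma Sigma1_evaluates: "Sigma1 (\<lambda>t. evaluates (prog_of (pfst t)) (pfst (psnd t)) (psnd (psnd t)))"
proof -
  define Q where "Q t c \<longleftrightarrow> lmem t c \<and>
    (\<forall>j<llen c. justified (\<lambda>u. lmem u (ldrop (Suc j) c))
     (pfst (lnth c j)) (pfst (psnd (lnth c j))) (psnd (psnd (lnth c j))))" for t c
  have Q: "Q t (list_encode L) \<longleftrightarrow> t \<in> set L \<and> valid_derivation L" for t L
    unfolding Q_def valid_iff_nth ldrop_list_encode lmem_list_encode llen_list_encode
    by (auto simp: lnth_list_encode)
  have "evaluates (prog_of (pfst t)) (pfst (psnd t)) (psnd (psnd t)) \<longleftrightarrow> (\<exists>c. Q t c)" for t
  proof
    assume "evaluates (prog_of (pfst t)) (pfst (psnd t)) (psnd (psnd t))"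
    from valid_complete[OF this] Q show "\<exists>c. Q t c" by auto
  next
    assume "\<exists>c. Q t c"
    then obtain L where "t \<in> set L" "valid_derivation L" using Q by (metis list_decode_inverse)
    then show "evaluates (prog_of (pfst t)) (pfst (psnd t)) (psnd (psnd t))"
      using valid_sound[of L "pfst t" "pfst (psnd t)" "psnd (psnd t)"] by simp
  qed
  moreover have "Sigma1 (\<lambda>t. \<exists>c. Q t c)"
    unfolding Q_def justified_def
    by (intro Sigma1_intros Sigma1_lmem computable_intros)
  ultimately show ?thesis by simp
qed

lemma Sigma1_mem_W:
  assumes "computable f" "computable g" shows "Sigma1 (\<lambda>x. f x \<in> W (g x))"
proof -
  have ev: "Sigma1 (\<lambda>x. evaluates (prog_of (g x)) (f x) (h x))"
    if "computable f" "computable g" "computable h" for f g h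
    using Sigma1_subst[OF Sigma1_evaluates, of "\<lambda>x. trip (g x) (f x) (h x)"] that
    by (simp add: computable_prod_encode)
  then show ?thesis unfolding mem_W_iff
    by (intro Sigma1_ex)
      (intro ev computable_comp[OF assms(1)] computable_comp[OF assms(2)] computable_intros)
qed

lemma ce_iff_Sigma1: "ce A \<longleftrightarrow> Sigma1 (\<lambda>x. x \<in> A)"
proof
  assume "ce A"
  then obtain e where "A = W e" unfolding ce_def by blast
  then show "Sigma1 (\<lambda>x. x \<in> A)"
    using Sigma1_mem_W[OF computable_id computable_const[of e]] by (simp only:)
next
  assume "Sigma1 (\<lambda>x. x \<in> A)"
  then obtain p where "\<And>x. x \<in> A \<longleftrightarrow> (\<exists>y. evaluates p x y)" by (rule Sigma1_imp_domain) blast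
  then have "A = W (prog_code p)" by (auto simp: mem_W_iff)
  then show "ce A" unfolding ce_def by blast
qed

section \<open>Computable parametrization of c.e. sets\<close>

primrec const_prog :: "nat \<Rightarrow> prog" where
  "const_prog 0 = Zero"
| "const_prog (Suc n) = Comp Succ (const_prog n)"

lemma evaluates_const_prog: "evaluates (const_prog n) x n"
  by (induction n) (auto intro: evaluates.intros)

text \<open>To fix \<open>n\<close>, the program for \<open>R\<close> is run on the pair of a
  constant program for \<open>n\<close> and the input; the code of the result depends computably on
  \<open>n\<close>.\<close>

lemma smn:
  assumes "Sigma1 (\<lambda>z. R (pfst z) (psnd z))"
  obtains f where "computable f" "\<And>n. W (f n) = {i. R n i}"
proof -
  obtain p where p: "\<And>z. R (pfst z) (psnd z) \<longleftrightarrow> (\<exists>y. evaluates p z y)"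
    using assms by (rule Sigma1_imp_domain) blast
  obtain i where i: "\<And>x. evaluates i x x" using computable_id unfolding computable_def by blast
  define q where "q n = Comp p (Pairing (const_prog n) i)" for n
  have pair: "evaluates (Pairing (const_prog n) i) x a \<longleftrightarrow> a = prod_encode (n, x)" for n x a
    using evaluates.Pairing[OF evaluates_const_prog i] evaluates_functional by metis
  have "(\<exists>y. evaluates (q n) x y) \<longleftrightarrow> R n x" for n x
    using p[of "prod_encode (n, x)"] pair unfolding q_def
    by (auto elim!: evaluates_elims(6)) (metis evaluates.Comp)
  then have W: "W (prog_code (q n)) = {i. R n i}" for n by (auto simp: mem_W_iff)
  \<comment> \<open>The 1 is the code of \<open>Succ\<close>: the codes of constant programs obey a
    primitive recursion.\<close>
  have c: "prog_code (const_prog n) = rec_nat 0 (\<lambda>k r. 5 + 4 * prod_encode (1, r)) n" for n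
    by (induction n) auto
  have "computable (\<lambda>n. prog_code (q n))"
    unfolding q_def prog_code.simps c by (intro computable_rec_nat computable_intros)
  then show ?thesis using W that by blast
qed

section \<open>Effective open sets, words and \<open>\<rho>\<close>\<close>

lemma uniformly_effective_openI:
  assumes "Sigma1 (\<lambda>z. R (pfst z) (psnd z))" and "\<And>n x. x \<in> U n \<longleftrightarrow> (\<exists>i. R n i \<and> x \<in> B i)"
  shows "uniformly_effective_open B U"
proof -
  obtain f where f: "computable f" "\<And>n. W (f n) = {i. R n i}" using assms(1) by (rule smn) blast
  have "\<forall>n. U n = (\<Union>i\<in>W (f n). B i)" using assms(2) f(2) by auto
  then show ?thesis unfolding uniformly_effective_open_def using f(1) by blast
qed

text \<open>Replaces computable indices by a relation \<open>R\<close>. Its semidecidability is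
  stated for arbitrary computable arguments so that it can serve as an introduction rule.\<close>

lemma uniformly_effective_openE:
  assumes "uniformly_effective_open B U"
  obtains R where "\<And>f g. computable f \<Longrightarrow> computable g \<Longrightarrow> Sigma1 (\<lambda>x. R (f x) (g x))"
    and "\<And>n x. x \<in> U n \<longleftrightarrow> (\<exists>i. R n i \<and> x \<in> B i)"
proof -
  obtain h where h: "computable h" "\<And>n. U n = (\<Union>i\<in>W (h n). B i)"
    using assms unfolding uniformly_effective_open_def by blast
  show ?thesis
  proof (rule that[of "\<lambda>n i. i \<in> W (h n)"])
    show "Sigma1 (\<lambda>x. g x \<in> W (h (f x)))" if "computable f" "computable g" for f g
      by (intro Sigma1_mem_W computable_comp[OF h(1)] that)
    show "x \<in> U n \<longleftrightarrow> (\<exists>i. i \<in> W (h n) \<and> x \<in> B i)" for n x using h(2) by auto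
  qed
qed

lemma Sigma02_Un:
  assumes "Sigma02 B A" "Sigma02 B A'" shows "Sigma02 B (A \<union> A')"
proof -
  have un: "uniformly_effective_open B (\<lambda>m. if pfst m = 0 then U (psnd m) else U' (psnd m))"
    if U: "uniformly_effective_open B U" "uniformly_effective_open B U'" for U U'
  proof -
    obtain R where R: "\<And>f g. computable f \<Longrightarrow> computable g \<Longrightarrow> Sigma1 (\<lambda>x. R (f x) (g x))"
      "\<And>n x. x \<in> U n \<longleftrightarrow> (\<exists>i. R n i \<and> x \<in> B i)"
      using U(1) by (rule uniformly_effective_openE) blast
    obtain R' where R': "\<And>f g. computable f \<Longrightarrow> computable g \<Longrightarrow> Sigma1 (\<lambda>x. R' (f x) (g x))"
      "\<And>n x. x \<in> U' n \<longleftrightarrow> (\<exists>i. R' n i \<and> x \<in> B i)"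
      using U(2) by (rule uniformly_effective_openE) blast
    show ?thesis
    proof (rule uniformly_effective_openI)
      show "Sigma1 (\<lambda>z. pfst (pfst z) = 0 \<and> R (psnd (pfst z)) (psnd z) \<or>
          0 < pfst (pfst z) \<and> R' (psnd (pfst z)) (psnd z))"
        by (intro Sigma1_intros R(1) R'(1) computable_intros)
    qed (auto simp: R(2) R'(2))
  qed
  obtain U V where UV: "uniformly_effective_open B U" "uniformly_effective_open B V"
    "A = (\<Union>n. U n - V n)" using assms(1) unfolding Sigma02_def by blast
  obtain U' V' where UV': "uniformly_effective_open B U'" "uniformly_effective_open B V'"
    "A' = (\<Union>n. U' n - V' n)" using assms(2) unfolding Sigma02_def by blast
  \<comment> \<open>Both sequences share one index set: first component 0 selects the first, any
    other value the second.\<close>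
  let ?U = "\<lambda>m. if pfst m = 0 then U (psnd m) else U' (psnd m)"
  let ?V = "\<lambda>m. if pfst m = 0 then V (psnd m) else V' (psnd m)"
  have "A \<union> A' = (\<Union>m. ?U m - ?V m)"
  proof (intro equalityI subsetI)
    fix x assume "x \<in> A \<union> A'"
    then obtain n where "x \<in> U n - V n \<or> x \<in> U' n - V' n" using UV(3) UV'(3) by blast
    then have "x \<in> ?U (prod_encode (0, n)) - ?V (prod_encode (0, n)) \<or>
        x \<in> ?U (prod_encode (1, n)) - ?V (prod_encode (1, n))" by simp
    then show "x \<in> (\<Union>m. ?U m - ?V m)" by blast
  qed (auto simp: UV(3) UV'(3) split: if_splits)
  then show ?thesis
    unfolding Sigma02_def using un[OF UV(1) UV'(1)] un[OF UV(2) UV'(2)] by blast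
qed

section \<open>Finite words, cylinders and names under \<open>\<rho>\<close>\<close>

definition extends :: "nat list \<Rightarrow> nat list \<Rightarrow> bool" where
  "extends \<sigma> \<tau> \<longleftrightarrow> length \<tau> \<le> length \<sigma> \<and> (\<forall>i<length \<tau>. \<sigma> ! i = \<tau> ! i)"

text \<open>Under \<open>\<rho>\<close> the digit 0 is a blank and \<open>n + 1\<close> announces
  \<open>n\<close>, so the compatible words are the finite beginnings of names of
  \<open>Y\<close>.\<close>

definition compatible :: "nat list \<Rightarrow> nat set \<Rightarrow> bool" where
  "compatible \<sigma> Y \<longleftrightarrow> (\<forall>k<length \<sigma>. \<sigma> ! k = 0 \<or> \<sigma> ! k - 1 \<in> Y)"

lemma length_list_decode: "length (list_decode s) = llen s"
  using llen_list_encode[of "list_decode s"] by simp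

lemma nth_list_decode: "i < llen s \<Longrightarrow> list_decode s ! i = lnth s i"
  using lnth_list_encode[of i "list_decode s"] by (simp add: length_list_decode)

lemma Sigma1_extends:
  assumes "computable f" "computable g"
  shows "Sigma1 (\<lambda>x. extends (list_decode (f x)) (list_decode (g x)))"
proof -
  have "extends (list_decode s) (list_decode t) \<longleftrightarrow>
      llen t < Suc (llen s) \<and> (\<forall>i<llen t. lnth s i = lnth t i)" for s t
    unfolding extends_def by (auto simp: length_list_decode nth_list_decode)
  then show ?thesis
    by (simp only:) (intro Sigma1_intros computable_intros computable_comp[OF assms(1)]
        computable_comp[OF assms(2)])
qed

lemma Sigma1_compatible:
  assumes "computable f" "computable g"
  shows "Sigma1 (\<lambda>x. compatible (list_decode (f x)) (set_decode (g x)))"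
proof -
  have "compatible (list_decode s) Y \<longleftrightarrow> (\<forall>i<llen s. lnth s i = 0 \<or> lnth s i - 1 \<in> Y)" for s Y
    unfolding compatible_def by (auto simp: length_list_decode nth_list_decode)
  then show ?thesis
    by (simp only:) (intro Sigma1_intros computable_intros computable_comp[OF assms(1)]
        computable_comp[OF assms(2)])
qed

lemma mem_set_decode_less: "n \<in> set_decode i \<Longrightarrow> n < i"
proof -
  assume "n \<in> set_decode i"
  then have "i div 2 ^ n \<noteq> 0" unfolding set_decode_def by (auto intro: ccontr)
  then have "2 ^ n \<le> i" by (metis div_less not_le)
  then show ?thesis using less_exp[of n] by linarith
qed

text \<open>Elements of a coded finite set are below the code, so the quantifier becomes a bounded
  one; non-membership is decidable too.\<close>

lemma Sigma1_ball_set_decode: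
  assumes "Sigma1 (\<lambda>z. P (pfst z) (psnd z))" "computable f"
  shows "Sigma1 (\<lambda>x. \<forall>n\<in>set_decode (f x). P x n)"
proof -
  have "(\<forall>n\<in>set_decode i. P x n) \<longleftrightarrow> (\<forall>n<i. n \<notin> set_decode i \<or> P x n)" for i x
    using mem_set_decode_less by blast
  then show ?thesis
    by (simp only:) (intro Sigma1_intros assms computable_comp[OF assms(2)] computable_intros)
qed

lemma lmem_iff: "lmem t s \<longleftrightarrow> t \<in> set (list_decode s)"
  using lmem_list_encode[of t "list_decode s"] by simp

lemma Sigma1_mem_list_decode:
  assumes "computable f" "computable g" shows "Sigma1 (\<lambda>x. f x \<in> set (list_decode (g x)))"
  using Sigma1_lmem[OF assms] unfolding lmem_iff .

lemmas Sigma1_set_intros = Sigma1_extends Sigma1_compatible Sigma1_ball_set_decode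
  Sigma1_mem_list_decode

lemma mem_cylinder_map: "p \<in> cylinder (map p [0..<n])"
  by (simp add: cylinder_def)

lemma extends_map: "p \<in> cylinder \<tau> \<Longrightarrow> length \<tau> \<le> n \<Longrightarrow> extends (map p [0..<n]) \<tau>"
  by (simp add: cylinder_def extends_def)

lemma cylinder_extends: "p \<in> cylinder \<sigma> \<Longrightarrow> extends \<sigma> \<tau> \<Longrightarrow> p \<in> cylinder \<tau>"
  unfolding cylinder_def extends_def by simp

lemma extends_cylinder:
  "p \<in> cylinder \<sigma> \<Longrightarrow> p \<in> cylinder \<tau> \<Longrightarrow> length \<tau> \<le> length \<sigma> \<Longrightarrow> extends \<sigma> \<tau>"
  unfolding cylinder_def extends_def by simp

lemma cylinder_limit:
  assumes ext: "\<And>k. extends (g (Suc k)) (g k)" and len: "\<And>k. k \<le> length (g k)"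
  obtains p where "\<And>k. p \<in> cylinder (g k)"
proof
  have "length (g k) \<le> length (g (k + d)) \<and> (\<forall>i<length (g k). g (k + d) ! i = g k ! i)" for k d
  proof (induction d)
    case (Suc d)
    then show ?case using ext[of "k + d"] by (auto simp: extends_def)
  qed simp
  then have mono: "g m ! i = g k ! i" if "k \<le> m" "i < length (g k)" for k m i
    using that by (metis le_add_diff_inverse)
  \<comment> \<open>Digit \<open>i\<close> is read off from \<open>g (Suc i)\<close>, whose length
    is at least \<open>i + 1\<close>.\<close>
  show "(\<lambda>i. g (Suc i) ! i) \<in> cylinder (g k)" for k
    unfolding cylinder_def
  proof (intro CollectI allI impI)
    fix i assume i: "i < length (g k)"
    have "i < length (g (Suc i))" using len[of "Suc i"] by simp
    then show "g (Suc i) ! i = g k ! i"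
      using i mono[of k "Suc i" i] mono[of "Suc i" k i] by (cases "k \<le> Suc i") auto
  qed
qed

lemma compatible_rho: "p \<in> cylinder \<sigma> \<Longrightarrow> compatible \<sigma> (\<rho> p)"
  unfolding cylinder_def compatible_def \<rho>_def by (auto, metis Suc_pred not_gr_zero)

lemma compatible_mono: "compatible \<sigma> Y \<Longrightarrow> Y \<subseteq> Z \<Longrightarrow> compatible \<sigma> Z"
  unfolding compatible_def by blast

text \<open>A word announces only finitely many numbers, so compatibility is an effectively open
  condition on \<open>Y\<close>.\<close>

lemma compatible_finite:
  "compatible \<sigma> Y \<longleftrightarrow> (\<exists>i. compatible \<sigma> (set_decode i) \<and> Y \<in> Pomega_basis i)"
proof
  assume Y: "compatible \<sigma> Y"
  let ?F = "{n. Suc n \<in> set \<sigma>}"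
  have "finite (Suc ` ?F)" by (rule finite_subset[of _ "set \<sigma>"]) auto
  then have F: "finite ?F" by (rule finite_imageD) simp
  have "n \<in> Y" if "n \<in> ?F" for n
    using that Y unfolding compatible_def in_set_conv_nth by fastforce
  moreover have "compatible \<sigma> ?F" unfolding compatible_def
    by (metis (mono_tags, lifting) Suc_pred' mem_Collect_eq not_gr_zero nth_mem)
  ultimately show "\<exists>i. compatible \<sigma> (set_decode i) \<and> Y \<in> Pomega_basis i"
    using F by (intro exI[of _ "set_encode ?F"]) (auto simp: Pomega_basis_def)
qed (auto simp: Pomega_basis_def intro: compatible_mono)

lemma compatible_fill:
  assumes "compatible \<sigma> Y" obtains p where "p \<in> cylinder \<sigma>" "\<rho> p = Y"
proof
  \<comment> \<open>After \<open>\<sigma>\<close>, the digit at distance \<open>n\<close> announces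
    \<open>n\<close> if \<open>n \<in> Y\<close> and is blank otherwise, which also covers empty
    \<open>Y\<close>.\<close>
  let ?p = "\<lambda>k. if k < length \<sigma> then \<sigma> ! k else if k - length \<sigma> \<in> Y then Suc (k - length \<sigma>) else 0"
  show "?p \<in> cylinder \<sigma>" by (simp add: cylinder_def)
  have "n \<in> \<rho> ?p" if "n \<in> Y" for n
    unfolding \<rho>_def using that by (intro CollectI exI[of _ "n + length \<sigma>"]) simp
  moreover have "n \<in> Y" if "n \<in> \<rho> ?p" for n
    using that assms unfolding \<rho>_def compatible_def by (auto split: if_splits)
  ultimately show "\<rho> ?p = Y" by blast
qed

text \<open>A finite subset of \<open>\<rho> p\<close> is announced by a long enough prefix of
  \<open>p\<close>; this is the computability of \<open>\<rho>\<close>.\<close>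

lemma rho_mem_Pomega_basis:
  "\<rho> p \<in> Pomega_basis i \<longleftrightarrow>
     (\<exists>s. (\<forall>n\<in>set_decode i. Suc n \<in> set (list_decode s)) \<and> p \<in> Baire_basis s)"
proof
  assume "\<rho> p \<in> Pomega_basis i"
  then have "\<forall>n\<in>set_decode i. \<exists>k. p k = Suc n" by (auto simp: Pomega_basis_def \<rho>_def)
  then obtain k where k: "\<And>n. n \<in> set_decode i \<Longrightarrow> p (k n) = Suc n" by metis
  obtain N where "\<And>n. n \<in> set_decode i \<Longrightarrow> k n < N"
    using finite_nat_bounded[of "k ` set_decode i"] by auto
  then have "\<forall>n\<in>set_decode i. Suc n \<in> set (map p [0..<N])"
    using k by (metis atLeast0LessThan atLeastLessThan_upt image_eqI lessThan_iff list.set_map)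
  then show "\<exists>s. (\<forall>n\<in>set_decode i. Suc n \<in> set (list_decode s)) \<and> p \<in> Baire_basis s"
    by (intro exI[of _ "list_encode (map p [0..<N])"]) (simp add: Baire_basis_def mem_cylinder_map)
next
  assume "\<exists>s. (\<forall>n\<in>set_decode i. Suc n \<in> set (list_decode s)) \<and> p \<in> Baire_basis s"
  then obtain s where "\<forall>n\<in>set_decode i. Suc n \<in> set (list_decode s)" "p \<in> cylinder (list_decode s)"
    by (auto simp: Baire_basis_def)
  then show "\<rho> p \<in> Pomega_basis i"
    unfolding Pomega_basis_def \<rho>_def cylinder_def in_set_conv_nth by fastforce
qed

section \<open>Transfer of overtness and \<open>Pi02\<close> along \<open>\<rho>\<close>\<close>

lemma computably_overt_rho:
  "computably_overt Baire_basis (\<rho> -` E) \<longleftrightarrow> computably_overt Pomega_basis E"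
proof
  assume "computably_overt Pomega_basis E"
  then have S: "Sigma1 (\<lambda>i. Pomega_basis i \<inter> E \<noteq> {})"
    unfolding computably_overt_def ce_iff_Sigma1 by simp
  \<comment> \<open>A cylinder meets the preimage iff its word is compatible with some
    \<open>Y \<in> E\<close>, and a finite part of that \<open>Y\<close> suffices.\<close>
  have "Baire_basis s \<inter> \<rho> -` E \<noteq> {} \<longleftrightarrow>
      (\<exists>i. Pomega_basis i \<inter> E \<noteq> {} \<and> compatible (list_decode s) (set_decode i))" for s
  proof
    assume "Baire_basis s \<inter> \<rho> -` E \<noteq> {}"
    then obtain p where p: "p \<in> cylinder (list_decode s)" "\<rho> p \<in> E" by (auto simp: Baire_basis_def)
    then show "\<exists>i. Pomega_basis i \<inter> E \<noteq> {} \<and> compatible (list_decode s) (set_decode i)"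
      using compatible_rho[OF p(1)] compatible_finite by blast
  next
    assume "\<exists>i. Pomega_basis i \<inter> E \<noteq> {} \<and> compatible (list_decode s) (set_decode i)"
    then obtain Y where "Y \<in> E" "compatible (list_decode s) Y" using compatible_finite by blast
    then show "Baire_basis s \<inter> \<rho> -` E \<noteq> {}"
      unfolding Baire_basis_def by (auto elim!: compatible_fill)
  qed
  moreover have "Sigma1 (\<lambda>s. \<exists>i. Pomega_basis i \<inter> E \<noteq> {} \<and> compatible (list_decode s) (set_decode i))"
    by (intro Sigma1_intros Sigma1_set_intros Sigma1_subst[OF S] computable_intros)
  ultimately show "computably_overt Baire_basis (\<rho> -` E)"
    unfolding computably_overt_def ce_iff_Sigma1 by simp
next
  assume "computably_overt Baire_basis (\<rho> -` E)"
  then have S: "Sigma1 (\<lambda>s. Baire_basis s \<inter> \<rho> -` E \<noteq> {})"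
    unfolding computably_overt_def ce_iff_Sigma1 by simp
  \<comment> \<open>Since \<open>\<rho>\<close> is onto, a basic set meets \<open>E\<close> iff some
    word announcing its finite set extends to a name of an element of \<open>E\<close>.\<close>
  have "Pomega_basis i \<inter> E \<noteq> {} \<longleftrightarrow> (\<exists>s. Baire_basis s \<inter> \<rho> -` E \<noteq> {} \<and>
      (\<forall>n\<in>set_decode i. Suc n \<in> set (list_decode s)))" for i
  proof
    assume "Pomega_basis i \<inter> E \<noteq> {}"
    then obtain Y where Y: "Y \<in> Pomega_basis i" "Y \<in> E" by blast
    obtain p where "\<rho> p = Y" using compatible_fill[of "[]" Y] by (auto simp: compatible_def)
    then show "\<exists>s. Baire_basis s \<inter> \<rho> -` E \<noteq> {} \<and> (\<forall>n\<in>set_decode i. Suc n \<in> set (list_decode s))"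
      using Y rho_mem_Pomega_basis[of p i] by blast
  next
    assume "\<exists>s. Baire_basis s \<inter> \<rho> -` E \<noteq> {} \<and> (\<forall>n\<in>set_decode i. Suc n \<in> set (list_decode s))"
    then show "Pomega_basis i \<inter> E \<noteq> {}" using rho_mem_Pomega_basis by blast
  qed
  moreover have "Sigma1 (\<lambda>i. \<exists>s. Baire_basis s \<inter> \<rho> -` E \<noteq> {} \<and>
      (\<forall>n\<in>set_decode i. Suc n \<in> set (list_decode s)))"
    by (intro Sigma1_intros Sigma1_set_intros Sigma1_subst[OF S] computable_intros)
  ultimately show "computably_overt Pomega_basis E"
    unfolding computably_overt_def ce_iff_Sigma1 by simp
qed

lemma uniformly_effective_open_rho:
  assumes "uniformly_effective_open Pomega_basis U"
  shows "uniformly_effective_open Baire_basis (\<lambda>n. \<rho> -` U n)"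
proof -
  obtain R where R: "\<And>f g. computable f \<Longrightarrow> computable g \<Longrightarrow> Sigma1 (\<lambda>x. R (f x) (g x))"
      "\<And>n x. x \<in> U n \<longleftrightarrow> (\<exists>i. R n i \<and> x \<in> Pomega_basis i)"
    using assms by (rule uniformly_effective_openE) blast
  show ?thesis
  proof (rule uniformly_effective_openI)
    show "Sigma1 (\<lambda>z. \<exists>i. R (pfst z) i \<and> (\<forall>n\<in>set_decode i. Suc n \<in> set (list_decode (psnd z))))"
      by (intro Sigma1_intros Sigma1_set_intros R(1) computable_intros)
  qed (auto simp: R(2) rho_mem_Pomega_basis)
qed

lemma Pi02_vimage_rho:
  assumes "Pi02 Pomega Pomega_basis E" shows "Pi02 Baire Baire_basis (\<rho> -` E)"
proof -
  obtain U V where "uniformly_effective_open Pomega_basis U" "uniformly_effective_open Pomega_basis V"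
    and E: "UNIV - E = (\<Union>n. U n - V n)"
    using assms unfolding Pi02_def Sigma02_def by auto
  moreover have "UNIV - \<rho> -` E = (\<Union>n. \<rho> -` U n - \<rho> -` V n)"
    using arg_cong[OF E, of "\<lambda>A. \<rho> -` A"] by (simp add: vimage_Diff vimage_UN)
  ultimately show ?thesis
    unfolding Pi02_def Sigma02_def topspace_Baire
    by (intro conjI subset_UNIV exI[of _ "\<lambda>n. \<rho> -` U n"] exI[of _ "\<lambda>n. \<rho> -` V n"]
        uniformly_effective_open_rho)
qed

text \<open>Effective Vaught transform: a \<open>\<rho>\<close>-saturated \<open>\<Pi>\<^sup>0\<^sub>2\<close> set contains the fibre over \<open>Y\<close> as soon as
  it is comeagre in it, and the latter is a \<open>\<Pi>\<^sup>0\<^sub>2\<close> condition on \<open>Y\<close>.\<close>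

lemma mem_iff_fibre_generic:
  fixes RU RV :: "nat \<Rightarrow> nat list \<Rightarrow> bool"
  assumes E: "\<And>p. \<rho> p \<in> E \<longleftrightarrow> (\<forall>n. (\<exists>t. RU n t \<and> p \<in> cylinder t) \<longrightarrow> (\<exists>t. RV n t \<and> p \<in> cylinder t))"
  shows "Y \<in> E \<longleftrightarrow> (\<forall>n \<sigma>. (\<exists>t. RU n t \<and> extends \<sigma> t) \<and> compatible \<sigma> Y \<longrightarrow>
           (\<exists>\<tau> t. extends \<tau> \<sigma> \<and> RV n t \<and> extends \<tau> t \<and> compatible \<tau> Y))"
    (is "_ \<longleftrightarrow> ?generic")
proof
  assume Y: "Y \<in> E"
  show ?generic
  proof (intro allI impI, elim conjE exE)
    fix n \<sigma> t assume t: "RU n t" "extends \<sigma> t" and \<sigma>: "compatible \<sigma> Y"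
    obtain p where p: "p \<in> cylinder \<sigma>" "\<rho> p = Y" using \<sigma> by (rule compatible_fill)
    then obtain u where u: "RV n u" "p \<in> cylinder u"
      using E[of p] Y t cylinder_extends[OF p(1) t(2)] by blast
    let ?\<tau> = "map p [0..<max (length \<sigma>) (length u)]"
    have "extends ?\<tau> \<sigma>" "extends ?\<tau> u" using p(1) u(2) by (simp_all add: extends_map)
    moreover have "compatible ?\<tau> Y" using compatible_rho[OF mem_cylinder_map] p(2) by blast
    ultimately show "\<exists>\<tau> t. extends \<tau> \<sigma> \<and> RV n t \<and> extends \<tau> t \<and> compatible \<tau> Y" using u(1) by blast
  qed
next
  assume G: ?generic
  \<comment> \<open>Stage \<open>k\<close> lengthens the word, announces \<open>k\<close> if
    \<open>k \<in> Y\<close>, and settles requirement \<open>k\<close>: either \<open>RV k\<close>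
    is forced, or no compatible extension can force \<open>RU k\<close>.\<close>
  define ok where "ok k \<sigma> \<tau> \<longleftrightarrow> extends \<tau> \<sigma> \<and> length \<sigma> < length \<tau> \<and> (k \<in> Y \<longrightarrow> Suc k \<in> set \<tau>) \<and>
     ((\<exists>t. RV k t \<and> extends \<tau> t) \<or>
      \<not> (\<exists>\<upsilon> t. extends \<upsilon> \<tau> \<and> compatible \<upsilon> Y \<and> RU k t \<and> extends \<upsilon> t))" for k \<sigma> \<tau>
  have trans: "extends a c" if "extends a b" "extends b c" for a b c
    using that unfolding extends_def by auto
  have sub: "set b \<subseteq> set a" if "extends a b" for a b
  proof
    fix x assume "x \<in> set b"
    then obtain i where "i < length b" "b ! i = x" by (auto simp: in_set_conv_nth)
    then have "i < length a" "a ! i = x" using that by (auto simp: extends_def)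
    then show "x \<in> set a" using nth_mem by blast
  qed
  have "\<exists>g. \<forall>k. compatible (g k) Y \<and> ok k (g k) (g (Suc k))"
  proof (rule dependent_nat_choice)
    show "\<exists>\<sigma>. compatible \<sigma> Y" by (intro exI[of _ "[]"]) (simp add: compatible_def)
    fix \<sigma> k assume \<sigma>: "compatible \<sigma> Y"
    \<comment> \<open>The appended digit does the first two jobs at once; 0 is a harmless
      blank.\<close>
    define \<sigma>' where "\<sigma>' = \<sigma> @ [if k \<in> Y then Suc k else 0]"
    have \<sigma>': "compatible \<sigma>' Y" "extends \<sigma>' \<sigma>" "length \<sigma> < length \<sigma>'" "k \<in> Y \<longrightarrow> Suc k \<in> set \<sigma>'"
      using \<sigma> by (auto simp: \<sigma>'_def compatible_def extends_def nth_append less_Suc_eq)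
    show "\<exists>\<tau>. compatible \<tau> Y \<and> ok k \<sigma> \<tau>"
    proof (cases "\<exists>\<upsilon> t. extends \<upsilon> \<sigma>' \<and> compatible \<upsilon> Y \<and> RU k t \<and> extends \<upsilon> t")
      case True
      then obtain \<upsilon> t where \<upsilon>: "extends \<upsilon> \<sigma>'" "compatible \<upsilon> Y" "RU k t" "extends \<upsilon> t" by blast
      then obtain \<tau> u where \<tau>: "extends \<tau> \<upsilon>" "RV k u" "extends \<tau> u" "compatible \<tau> Y" using G by blast
      have e: "extends \<tau> \<sigma>'" using trans \<tau>(1) \<upsilon>(1) .
      have "extends \<tau> \<sigma>" using trans e \<sigma>'(2) .
      moreover have "length \<sigma> < length \<tau>" using e \<sigma>'(3) by (simp add: extends_def)
      ultimately show ?thesis unfolding ok_def using \<tau> sub[OF e] \<sigma>'(4) by blast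
    next
      case False then show ?thesis unfolding ok_def using \<sigma>' by blast
    qed
  qed
  then obtain g where g: "\<And>k. compatible (g k) Y" "\<And>k. ok k (g k) (g (Suc k))" by blast
  have len: "k \<le> length (g k)" for k
  proof (induction k)
    case (Suc k) then show ?case using g(2)[of k] by (auto simp: ok_def)
  qed simp
  obtain p where p: "\<And>k. p \<in> cylinder (g k)"
    by (rule cylinder_limit[of g]) (use g(2) len in \<open>auto simp: ok_def\<close>)
  have "\<rho> p = Y"
  proof (intro equalityI subsetI)
    fix n assume "n \<in> \<rho> p"
    then obtain i where "p i = Suc n" by (auto simp: \<rho>_def)
    then have "g (Suc i) ! i = Suc n" "i < length (g (Suc i))"
      using p[of "Suc i"] len[of "Suc i"] by (auto simp: cylinder_def)
    then show "n \<in> Y" using g(1)[of "Suc i"] by (fastforce simp: compatible_def)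
  next
    fix n assume "n \<in> Y"
    then have "Suc n \<in> set (g (Suc n))" using g(2) by (auto simp: ok_def)
    then show "n \<in> \<rho> p" using p[of "Suc n"] by (auto simp: in_set_conv_nth cylinder_def \<rho>_def) metis
  qed
  moreover have "\<exists>t. RV n t \<and> p \<in> cylinder t" if t: "RU n t" "p \<in> cylinder t" for n t
  proof -
    \<comment> \<open>This prefix of \<open>p\<close> is a compatible extension of
      \<open>g (Suc n)\<close> that forces \<open>RU n\<close>, so the second alternative of stage
      \<open>n\<close> is excluded.\<close>
    let ?\<upsilon> = "map p [0..<max (length t) (length (g (Suc n)))]"
    have "extends ?\<upsilon> (g (Suc n))" "extends ?\<upsilon> t" using p t(2) by (simp_all add: extends_map)
    moreover have "compatible ?\<upsilon> Y" using compatible_rho[OF mem_cylinder_map] \<open>\<rho> p = Y\<close> by blast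
    ultimately obtain u where "RV n u" "extends (g (Suc n)) u"
      using g(2)[of n] t(1) unfolding ok_def by blast
    then show ?thesis using cylinder_extends[OF p] by blast
  qed
  ultimately show "Y \<in> E" using E[of p] by blast
qed

lemma all_list_decode: "(\<forall>\<sigma>. P \<sigma>) \<longleftrightarrow> (\<forall>s. P (list_decode s))"
  and ex_list_decode: "(\<exists>\<sigma>. P \<sigma>) \<longleftrightarrow> (\<exists>s. P (list_decode s))"
  by (metis list_encode_inverse)+

lemma all_pfst_psnd: "(\<forall>n s. P n s) \<longleftrightarrow> (\<forall>m. P (pfst m) (psnd m))"
  by (metis pfst_prod_encode psnd_prod_encode)

text \<open>The condition of \<open>mem_iff_fibre_generic\<close> ranges over pairs of a number and
  a word, and for each pair both sides of the implication are effectively open in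
  \<open>Y\<close>.\<close>

lemma Pi02_if_vimage_rho:
  assumes "Pi02 Baire Baire_basis (\<rho> -` E)" shows "Pi02 Pomega Pomega_basis E"
proof -
  obtain U V where UV: "uniformly_effective_open Baire_basis U" "uniformly_effective_open Baire_basis V"
    and E: "UNIV - \<rho> -` E = (\<Union>n. U n - V n)"
    using assms unfolding Pi02_def Sigma02_def by auto
  obtain RU where RU: "\<And>f g. computable f \<Longrightarrow> computable g \<Longrightarrow> Sigma1 (\<lambda>x. RU (f x) (g x))"
      "\<And>n x. x \<in> U n \<longleftrightarrow> (\<exists>i. RU n i \<and> x \<in> Baire_basis i)"
    using UV(1) by (rule uniformly_effective_openE) blast
  obtain RV where RV: "\<And>f g. computable f \<Longrightarrow> computable g \<Longrightarrow> Sigma1 (\<lambda>x. RV (f x) (g x))"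
      "\<And>n x. x \<in> V n \<longleftrightarrow> (\<exists>i. RV n i \<and> x \<in> Baire_basis i)"
    using UV(2) by (rule uniformly_effective_openE) blast
  have E': "\<rho> p \<in> E \<longleftrightarrow> (\<forall>n. (\<exists>t. RU n (list_encode t) \<and> p \<in> cylinder t) \<longrightarrow>
      (\<exists>t. RV n (list_encode t) \<and> p \<in> cylinder t))" for p
  proof -
    have "\<rho> p \<notin> E \<longleftrightarrow> (\<exists>n. p \<in> U n \<and> p \<notin> V n)" using E by auto
    then show ?thesis
      unfolding RU(2) RV(2) Baire_basis_def ex_list_decode list_decode_inverse by blast
  qed
  \<comment> \<open>\<open>m\<close> codes a requirement and a word; if the word does not force
    \<open>RU\<close>, then \<open>U' m\<close> is empty and nothing is demanded.\<close>
  define U' where "U' m = {Y. (\<exists>t. RU (pfst m) t \<and> extends (list_decode (psnd m)) (list_decode t)) \<and>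
      compatible (list_decode (psnd m)) Y}" for m
  define V' where "V' m = {Y. \<exists>s t. extends (list_decode s) (list_decode (psnd m)) \<and> RV (pfst m) t \<and>
      extends (list_decode s) (list_decode t) \<and> compatible (list_decode s) Y}" for m
  have "Y \<in> E \<longleftrightarrow> (\<forall>m. Y \<in> U' m \<longrightarrow> Y \<in> V' m)" for Y
    unfolding mem_iff_fibre_generic[OF E'] all_list_decode ex_list_decode list_decode_inverse
      U'_def V'_def mem_Collect_eq by (rule all_pfst_psnd)
  then have "UNIV - E = (\<Union>m. U' m - V' m)" by blast
  moreover have "uniformly_effective_open Pomega_basis U'"
  proof (rule uniformly_effective_openI)
    show "Sigma1 (\<lambda>z. (\<exists>t. RU (pfst (pfst z)) t \<and> extends (list_decode (psnd (pfst z))) (list_decode t)) \<and>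
      compatible (list_decode (psnd (pfst z))) (set_decode (psnd z)))"
      by (intro Sigma1_intros Sigma1_set_intros RU(1) computable_intros)
    show "Y \<in> U' m \<longleftrightarrow> (\<exists>i. ((\<exists>t. RU (pfst m) t \<and> extends (list_decode (psnd m)) (list_decode t)) \<and>
      compatible (list_decode (psnd m)) (set_decode i)) \<and> Y \<in> Pomega_basis i)" for m Y
      unfolding U'_def mem_Collect_eq compatible_finite[of _ Y] by blast
  qed
  moreover have "uniformly_effective_open Pomega_basis V'"
  proof (rule uniformly_effective_openI)
    show "Sigma1 (\<lambda>z. \<exists>s t. extends (list_decode s) (list_decode (psnd (pfst z))) \<and> RV (pfst (pfst z)) t \<and>
      extends (list_decode s) (list_decode t) \<and> compatible (list_decode s) (set_decode (psnd z)))"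
      by (intro Sigma1_intros Sigma1_set_intros RV(1) computable_intros)
    show "Y \<in> V' m \<longleftrightarrow> (\<exists>i. (\<exists>s t. extends (list_decode s) (list_decode (psnd m)) \<and> RV (pfst m) t \<and>
      extends (list_decode s) (list_decode t) \<and> compatible (list_decode s) (set_decode i)) \<and>
        Y \<in> Pomega_basis i)" for m Y
      unfolding V'_def mem_Collect_eq compatible_finite[of _ Y] by blast
  qed
  ultimately show ?thesis unfolding Pi02_def Sigma02_def by auto
qed

section \<open>Images of effectively open maps\<close>

lemma effective_topological_spaceD:
  assumes "effective_topological_space X B"
  shows basis_subset: "B n \<subseteq> topspace X"
    and basis_cover: "x \<in> topspace X \<Longrightarrow> \<exists>n. x \<in> B n"
    and inj_canonical_embedding: "inj_on (canonical_embedding B) (topspace X)"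
proof -
  have t0: "t0_space X" and op: "openin X = arbitrary union_of (\<lambda>U. U \<in> range B)"
    using assms unfolding effective_topological_space_def by auto
  have opn: "openin X (B n)" for n
    using op unfolding openin_topology_base_unique by blast
  have bas: "\<exists>n. x \<in> B n \<and> B n \<subseteq> U" if "openin X U" "x \<in> U" for U x
    using op that unfolding openin_topology_base_unique by blast
  show "B n \<subseteq> topspace X" using opn openin_subset by blast
  show "\<exists>n. x \<in> B n" if "x \<in> topspace X" using bas[of "topspace X"] that by blast
  show "inj_on (canonical_embedding B) (topspace X)"
  proof (rule inj_onI, rule ccontr)
    fix x y assume xy: "x \<in> topspace X" "y \<in> topspace X" "x \<noteq> y"
      and eq: "canonical_embedding B x = canonical_embedding B y"
    have B: "x \<in> B n \<longleftrightarrow> y \<in> B n" for n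
      using eq unfolding canonical_embedding_def by blast
    obtain U where "openin X U" "x \<notin> U \<longleftrightarrow> y \<in> U" using t0 xy unfolding t0_space_def by blast
    then show False using bas[of U x] bas[of U y] B by blast
  qed
qed

lemma dom_standard_representation:
  "dom (standard_representation X B) = \<rho> -` (canonical_embedding B ` topspace X)"
  by (auto simp: standard_representation_def split: if_splits)

lemma Sigma02I:
  assumes "Sigma1 (\<lambda>z. R (pfst z) (psnd z))" "Sigma1 (\<lambda>z. R' (pfst z) (psnd z))"
    and "\<And>x. x \<in> A \<longleftrightarrow> (\<exists>m. (\<exists>i. R m i \<and> x \<in> B i) \<and> \<not> (\<exists>i. R' m i \<and> x \<in> B i))"
  shows "Sigma02 B A"
proof -
  have "uniformly_effective_open B (\<lambda>m. {x. \<exists>i. R m i \<and> x \<in> B i})"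
    by (rule uniformly_effective_openI[OF assms(1)]) simp
  moreover have "uniformly_effective_open B (\<lambda>m. {x. \<exists>i. R' m i \<and> x \<in> B i})"
    by (rule uniformly_effective_openI[OF assms(2)]) simp
  moreover have "A = (\<Union>m. {x. \<exists>i. R m i \<and> x \<in> B i} - {x. \<exists>i. R' m i \<and> x \<in> B i})"
    using assms(3) by auto
  ultimately show ?thesis unfolding Sigma02_def by blast
qed

lemma set_decode_surj: assumes "finite F" obtains i where "set_decode i = F"
  using set_encode_inverse[OF assms] that by blast

lemma mem_iff_Pomega_basis: "k \<in> Y \<longleftrightarrow> (\<exists>i. k \<in> set_decode i \<and> Y \<in> Pomega_basis i)"
proof
  assume "k \<in> Y"
  moreover obtain i where "set_decode i = {k}" using set_decode_surj[of "{k}"] by auto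
  ultimately show "\<exists>i. k \<in> set_decode i \<and> Y \<in> Pomega_basis i"
    by (intro exI[of _ i]) (simp add: Pomega_basis_def)
qed (auto simp: Pomega_basis_def)

lemma ex_mem_Pomega_basis: "\<exists>i. Y \<in> Pomega_basis i"
  by (intro exI[of _ 0]) (simp add: Pomega_basis_def)

text \<open>\<open>M s Y\<close> is aliveness of the word \<open>s\<close>, and 0 codes the empty
  word. If \<open>Y\<close> is the embedding of \<open>x\<close>, alive means that \<open>x\<close>
  is a value of \<open>f\<close> on the cylinder. Conversely, \<open>?refine\<close> builds a point
  \<open>p\<close> with \<open>f p\<close> in all \<open>B n\<close> for \<open>n \<in> Y\<close>,
  and \<open>?closed\<close> excludes further basic sets.\<close>

lemma quasi_Polish_image_mem_iff:
  fixes RG RH :: "nat \<Rightarrow> nat \<Rightarrow> bool"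
  assumes f: "range f = topspace X"
    and G: "\<And>n p. f p \<in> B n \<longleftrightarrow> (\<exists>t. RG n t \<and> p \<in> cylinder (list_decode t))"
    and H: "\<And>s x. x \<in> f ` cylinder (list_decode s) \<longleftrightarrow> (\<exists>k. RH s k \<and> x \<in> B k)"
  defines "M \<equiv> \<lambda>s Y. \<exists>k. RH s k \<and> k \<in> Y"
  shows "Y \<in> canonical_embedding B ` topspace X \<longleftrightarrow> M 0 Y \<and>
    (\<forall>s n. M s Y \<and> n \<in> Y \<longrightarrow> (\<exists>s' t. extends (list_decode s') (list_decode s) \<and> llen s < llen s' \<and>
       RG n t \<and> extends (list_decode s') (list_decode t) \<and> M s' Y)) \<and>
    (\<forall>s n. M s Y \<and> (\<exists>t. RG n t \<and> extends (list_decode s) (list_decode t)) \<longrightarrow> n \<in> Y)"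
    (is "_ \<longleftrightarrow> M 0 Y \<and> ?refine \<and> ?closed")
proof
  assume "Y \<in> canonical_embedding B ` topspace X"
  then obtain x where x: "x \<in> topspace X" and Y: "Y = {n. x \<in> B n}"
    by (auto simp: canonical_embedding_def)
  have M: "M s Y \<longleftrightarrow> x \<in> f ` cylinder (list_decode s)" for s
    unfolding H M_def Y by simp
  have "M 0 Y" unfolding M using x f by (simp add: cylinder_def)
  moreover have ?refine
  proof (intro allI impI, elim conjE)
    fix s n assume "M s Y" "n \<in> Y"
    then obtain p where p: "p \<in> cylinder (list_decode s)" "x = f p" "f p \<in> B n"
      unfolding M unfolding Y by blast
    then obtain t where t: "RG n t" "p \<in> cylinder (list_decode t)" using G by blast
    let ?\<tau> = "map p [0..<max (Suc (llen s)) (llen t)]"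
    have "extends ?\<tau> (list_decode s)" "extends ?\<tau> (list_decode t)"
      using p(1) t(2) by (auto intro!: extends_map simp: length_list_decode)
    moreover have "M (list_encode ?\<tau>) Y"
      unfolding M p(2) list_encode_inverse using mem_cylinder_map by (rule imageI)
    ultimately show "\<exists>s' t. extends (list_decode s') (list_decode s) \<and> llen s < llen s' \<and>
       RG n t \<and> extends (list_decode s') (list_decode t) \<and> M s' Y"
      using t(1) by (intro exI[of _ "list_encode ?\<tau>"] exI[of _ t]) (simp add: llen_list_encode)
  qed
  moreover have ?closed
    unfolding M unfolding Y using G cylinder_extends by blast
  ultimately show "M 0 Y \<and> ?refine \<and> ?closed" by blast
next
  assume R: "M 0 Y \<and> ?refine \<and> ?closed"
  \<comment> \<open>\<open>M 0 Y\<close> provides an element of \<open>Y\<close>, so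
    \<open>Y\<close> has an enumeration \<open>y\<close>, with repetitions if it is finite.\<close>
  then have "Y \<noteq> {}" by (auto simp: M_def)
  then obtain y :: "nat \<Rightarrow> nat" where y: "range y = Y"
    using range_from_nat_into[of Y] by blast
  have "\<exists>g. \<forall>k. M (g k) Y \<and> (extends (list_decode (g (Suc k))) (list_decode (g k)) \<and>
      llen (g k) < llen (g (Suc k)) \<and>
      (\<exists>t. RG (y k) t \<and> extends (list_decode (g (Suc k))) (list_decode t)))"
  proof (rule dependent_nat_choice)
    show "\<exists>s. M s Y" using R by blast
    fix s k assume "M s Y"
    moreover have "y k \<in> Y" using y by blast
    ultimately show "\<exists>s'. M s' Y \<and> (extends (list_decode s') (list_decode s) \<and> llen s < llen s' \<and>
      (\<exists>t. RG (y k) t \<and> extends (list_decode s') (list_decode t)))" using R by meson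
  qed
  then obtain g where g: "\<And>k. M (g k) Y" "\<And>k. extends (list_decode (g (Suc k))) (list_decode (g k))"
    "\<And>k. llen (g k) < llen (g (Suc k))"
    "\<And>k. \<exists>t. RG (y k) t \<and> extends (list_decode (g (Suc k))) (list_decode t)" by blast
  have len: "k \<le> length (list_decode (g k))" for k
  proof (induction k)
    case (Suc k) then show ?case using g(3)[of k] by (simp add: length_list_decode)
  qed simp
  obtain p where p: "\<And>k. p \<in> cylinder (list_decode (g k))"
    by (rule cylinder_limit[of "\<lambda>k. list_decode (g k)"]) (use g(2) len in auto)
  have "n \<in> Y \<longleftrightarrow> f p \<in> B n" for n
  proof
    assume "n \<in> Y"
    then obtain k where "n = y k" using y by blast
    then show "f p \<in> B n" using g(4)[of k] G cylinder_extends[OF p] by blast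
  next
    assume "f p \<in> B n"
    then obtain t where t: "RG n t" "p \<in> cylinder (list_decode t)" using G by blast
    have "extends (list_decode (g (llen t))) (list_decode t)"
      using p t(2) len[of "llen t"] by (intro extends_cylinder) (auto simp: length_list_decode)
    then show "n \<in> Y" using R g(1) t(1) by blast
  qed
  then have "Y = canonical_embedding B (f p)" by (auto simp: canonical_embedding_def)
  then show "Y \<in> canonical_embedding B ` topspace X" using f by blast
qed

lemma effective_quasi_Polish_imp_overt_Pi02:
  assumes X: "effective_topological_space X B" and qP: "effective_quasi_Polish X B"
  shows "computably_overt Pomega_basis (canonical_embedding B ` topspace X)"
    and "Pi02 Pomega Pomega_basis (canonical_embedding B ` topspace X)"
proof -
  let ?E = "canonical_embedding B ` topspace X"
  have "computably_overt Pomega_basis ?E \<and> Pi02 Pomega Pomega_basis ?E"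
  proof (cases "topspace X = {}")
    case True
    \<comment> \<open>No map is available here; the complement of the image is the whole space minus
      the empty set.\<close>
    have "Sigma02 Pomega_basis UNIV"
      by (rule Sigma02I[where R = "\<lambda>_ _. True" and R' = "\<lambda>_ _. False"])
        (auto intro: Sigma1_const simp: ex_mem_Pomega_basis)
    then show ?thesis
      using True by (simp add: computably_overt_def Pi02_def ce_iff_Sigma1 Sigma1_const)
  next
    case False
    then obtain f where f: "computable_map Baire Baire_basis X B f" "effectively_open_map B f"
      "range f = topspace X"
      using qP unfolding effective_quasi_Polish_def by auto
    have "uniformly_effective_open Baire_basis (\<lambda>n. {p. f p \<in> B n})"
      using f(1) unfolding computable_map_def by simp
    then obtain RG where
      RG: "\<And>f g. computable f \<Longrightarrow> computable g \<Longrightarrow> Sigma1 (\<lambda>x. RG (f x) (g x))"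
      and "\<And>n p. p \<in> {p. f p \<in> B n} \<longleftrightarrow> (\<exists>t. RG n t \<and> p \<in> Baire_basis t)"
      by (rule uniformly_effective_openE) blast
    then have G: "f p \<in> B n \<longleftrightarrow> (\<exists>t. RG n t \<and> p \<in> cylinder (list_decode t))" for n p
      by (simp add: Baire_basis_def)
    obtain U where U: "uniformly_effective_open B U" "\<And>\<sigma>. f ` cylinder \<sigma> = U (list_encode \<sigma>)"
      using f(2) unfolding effectively_open_map_def by blast
    obtain RH where
      RH: "\<And>f g. computable f \<Longrightarrow> computable g \<Longrightarrow> Sigma1 (\<lambda>x. RH (f x) (g x))"
      and "\<And>s x. x \<in> U s \<longleftrightarrow> (\<exists>k. RH s k \<and> x \<in> B k)"
      using U(1) by (rule uniformly_effective_openE) blast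
    then have H: "x \<in> f ` cylinder (list_decode s) \<longleftrightarrow> (\<exists>k. RH s k \<and> x \<in> B k)" for s x
      by (simp add: U(2))
    \<comment> \<open>A basic set meets the image iff a single word forces
      \<open>f p \<in> B n\<close> for all \<open>n\<close> of its finite set.\<close>
    have "Pomega_basis i \<inter> ?E \<noteq> {} \<longleftrightarrow>
        (\<exists>s. \<forall>n\<in>set_decode i. \<exists>t. RG n t \<and> extends (list_decode s) (list_decode t))" for i
    proof
      assume "Pomega_basis i \<inter> ?E \<noteq> {}"
      then obtain x where "x \<in> topspace X" and x: "set_decode i \<subseteq> {n. x \<in> B n}"
        unfolding Pomega_basis_def canonical_embedding_def by blast
      then obtain p where "x = f p" using f(3) by blast
      with x have p: "\<And>n. n \<in> set_decode i \<Longrightarrow> f p \<in> B n" by blast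
      then obtain t where t: "\<And>n. n \<in> set_decode i \<Longrightarrow> RG n (t n) \<and> p \<in> cylinder (list_decode (t n))"
        unfolding G by metis
      obtain N where N: "\<And>n. n \<in> set_decode i \<Longrightarrow> llen (t n) < N"
        using finite_nat_bounded[of "(\<lambda>n. llen (t n)) ` set_decode i"] by auto
      have "extends (map p [0..<N]) (list_decode (t n))" if "n \<in> set_decode i" for n
        using t[OF that] N[OF that] by (intro extends_map) (auto simp: length_list_decode)
      then show "\<exists>s. \<forall>n\<in>set_decode i. \<exists>t. RG n t \<and> extends (list_decode s) (list_decode t)"
        using t by (intro exI[of _ "list_encode (map p [0..<N])"]) (metis list_encode_inverse)
    next
      assume "\<exists>s. \<forall>n\<in>set_decode i. \<exists>t. RG n t \<and> extends (list_decode s) (list_decode t)"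
      then obtain s where
        s: "\<And>n. n \<in> set_decode i \<Longrightarrow> \<exists>t. RG n t \<and> extends (list_decode s) (list_decode t)" by blast
      \<comment> \<open>Values beyond the end of the list do not matter: any point of the cylinder
        will do.\<close>
      define p where "p k = list_decode s ! k" for k
      have "p \<in> cylinder (list_decode s)" by (simp add: cylinder_def p_def)
      then have "f p \<in> B n" if "n \<in> set_decode i" for n
        using s[OF that] cylinder_extends G by blast
      then have "canonical_embedding B (f p) \<in> Pomega_basis i"
        by (auto simp: Pomega_basis_def canonical_embedding_def)
      then show "Pomega_basis i \<inter> ?E \<noteq> {}" using f(3) by blast
    qed
    moreover have "Sigma1 (\<lambda>i. \<exists>s. \<forall>n\<in>set_decode i. \<exists>t. RG n t \<and> extends (list_decode s) (list_decode t))"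
      by (intro Sigma1_intros Sigma1_set_intros RG computable_intros)
    ultimately have overt: "computably_overt Pomega_basis ?E"
      unfolding computably_overt_def ce_iff_Sigma1 by simp
    have M: "(\<exists>k. RH s k \<and> k \<in> Y) \<longleftrightarrow> (\<exists>i. (\<exists>k. RH s k \<and> k \<in> set_decode i) \<and> Y \<in> Pomega_basis i)" for s Y
      unfolding mem_iff_Pomega_basis[of _ Y] by blast
    note mem = quasi_Polish_image_mem_iff[OF f(3) G H]
    \<comment> \<open>The complement of the image collects the failures of the three conditions in
      \<open>mem\<close>; each kind of failure is a \<open>Sigma02\<close> set.\<close>
    have "Sigma02 Pomega_basis {Y. \<not> (\<exists>k. RH 0 k \<and> k \<in> Y)}"
    proof (rule Sigma02I)
      show "Sigma1 (\<lambda>z. True)" by (rule Sigma1_const)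
      show "Sigma1 (\<lambda>z. \<exists>k. RH 0 k \<and> k \<in> set_decode (psnd z))"
        by (intro Sigma1_intros RH computable_intros)
      show "Y \<in> {Y. \<not> (\<exists>k. RH 0 k \<and> k \<in> Y)} \<longleftrightarrow> (\<exists>m::nat. (\<exists>i. True \<and> Y \<in> Pomega_basis i) \<and>
          \<not> (\<exists>i. (\<exists>k. RH 0 k \<and> k \<in> set_decode i) \<and> Y \<in> Pomega_basis i))" for Y
        using M[of 0 Y] ex_mem_Pomega_basis[of Y] by blast
    qed
    moreover have "Sigma02 Pomega_basis {Y. \<exists>m. ((\<exists>k. RH (pfst m) k \<and> k \<in> Y) \<and> psnd m \<in> Y) \<and>
        \<not> (\<exists>s' t. extends (list_decode s') (list_decode (pfst m)) \<and> llen (pfst m) < llen s' \<and>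
       RG (psnd m) t \<and> extends (list_decode s') (list_decode t) \<and> (\<exists>k. RH s' k \<and> k \<in> Y))}"
    proof (rule Sigma02I)
      show "Sigma1 (\<lambda>z. (\<exists>k. RH (pfst (pfst z)) k \<and> k \<in> set_decode (psnd z)) \<and>
          psnd (pfst z) \<in> set_decode (psnd z))"
        by (intro Sigma1_intros RH computable_intros)
      show "Sigma1 (\<lambda>z. \<exists>s' t. extends (list_decode s') (list_decode (pfst (pfst z))) \<and>
          llen (pfst (pfst z)) < llen s' \<and> RG (psnd (pfst z)) t \<and>
          extends (list_decode s') (list_decode t) \<and> (\<exists>k. RH s' k \<and> k \<in> set_decode (psnd z)))"
        by (intro Sigma1_intros Sigma1_set_intros RH RG computable_intros)
      \<comment> \<open>Both elements \<open>k\<close> and \<open>n\<close> of \<open>Y\<close> go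
        into one finite set, which makes the conjunction a union of basic sets.\<close>
      have *: "((\<exists>k. RH s k \<and> k \<in> Y) \<and> n \<in> Y) \<longleftrightarrow>
         (\<exists>i. ((\<exists>k. RH s k \<and> k \<in> set_decode i) \<and> n \<in> set_decode i) \<and> Y \<in> Pomega_basis i)" for s n Y
      proof
        assume "(\<exists>k. RH s k \<and> k \<in> Y) \<and> n \<in> Y"
        then obtain k where "RH s k" "k \<in> Y" "n \<in> Y" by blast
        moreover obtain i where "set_decode i = {k, n}" using set_decode_surj[of "{k, n}"] by auto
        ultimately show "\<exists>i. ((\<exists>k. RH s k \<and> k \<in> set_decode i) \<and> n \<in> set_decode i) \<and> Y \<in> Pomega_basis i"
          by (intro exI[of _ i]) (auto simp: Pomega_basis_def)
      qed (auto simp: Pomega_basis_def)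
      show "Y \<in> {Y. \<exists>m. ((\<exists>k. RH (pfst m) k \<and> k \<in> Y) \<and> psnd m \<in> Y) \<and>
        \<not> (\<exists>s' t. extends (list_decode s') (list_decode (pfst m)) \<and> llen (pfst m) < llen s' \<and>
       RG (psnd m) t \<and> extends (list_decode s') (list_decode t) \<and> (\<exists>k. RH s' k \<and> k \<in> Y))} \<longleftrightarrow>
        (\<exists>m. (\<exists>i. ((\<exists>k. RH (pfst m) k \<and> k \<in> set_decode i) \<and> psnd m \<in> set_decode i) \<and> Y \<in> Pomega_basis i) \<and>
         \<not> (\<exists>i. (\<exists>s' t. extends (list_decode s') (list_decode (pfst m)) \<and> llen (pfst m) < llen s' \<and>
       RG (psnd m) t \<and> extends (list_decode s') (list_decode t) \<and> (\<exists>k. RH s' k \<and> k \<in> set_decode i)) \<and>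
         Y \<in> Pomega_basis i))" for Y
        unfolding mem_Collect_eq *[of _ Y] unfolding M[of _ Y] by blast
    qed
    moreover have "Sigma02 Pomega_basis {Y. \<exists>m. ((\<exists>k. RH (pfst m) k \<and> k \<in> Y) \<and>
        (\<exists>t. RG (psnd m) t \<and> extends (list_decode (pfst m)) (list_decode t))) \<and> \<not> psnd m \<in> Y}"
    proof (rule Sigma02I)
      show "Sigma1 (\<lambda>z. (\<exists>k. RH (pfst (pfst z)) k \<and> k \<in> set_decode (psnd z)) \<and>
          (\<exists>t. RG (psnd (pfst z)) t \<and> extends (list_decode (pfst (pfst z))) (list_decode t)))"
        by (intro Sigma1_intros Sigma1_set_intros RH RG computable_intros)
      show "Sigma1 (\<lambda>z. psnd (pfst z) \<in> set_decode (psnd z))"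
        by (intro Sigma1_intros computable_intros)
      show "Y \<in> {Y. \<exists>m. ((\<exists>k. RH (pfst m) k \<and> k \<in> Y) \<and>
        (\<exists>t. RG (psnd m) t \<and> extends (list_decode (pfst m)) (list_decode t))) \<and> \<not> psnd m \<in> Y} \<longleftrightarrow>
        (\<exists>m. (\<exists>i. ((\<exists>k. RH (pfst m) k \<and> k \<in> set_decode i) \<and>
          (\<exists>t. RG (psnd m) t \<and> extends (list_decode (pfst m)) (list_decode t))) \<and> Y \<in> Pomega_basis i) \<and>
         \<not> (\<exists>i. psnd m \<in> set_decode i \<and> Y \<in> Pomega_basis i))" for Y
        unfolding mem_Collect_eq M[of _ Y] unfolding mem_iff_Pomega_basis[of _ Y] by blast
    qed
    ultimately have "Sigma02 Pomega_basis ({Y. \<not> (\<exists>k. RH 0 k \<and> k \<in> Y)} \<union>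
      ({Y. \<exists>m. ((\<exists>k. RH (pfst m) k \<and> k \<in> Y) \<and> psnd m \<in> Y) \<and>
        \<not> (\<exists>s' t. extends (list_decode s') (list_decode (pfst m)) \<and> llen (pfst m) < llen s' \<and>
       RG (psnd m) t \<and> extends (list_decode s') (list_decode t) \<and> (\<exists>k. RH s' k \<and> k \<in> Y))} \<union>
      {Y. \<exists>m. ((\<exists>k. RH (pfst m) k \<and> k \<in> Y) \<and>
        (\<exists>t. RG (psnd m) t \<and> extends (list_decode (pfst m)) (list_decode t))) \<and> \<not> psnd m \<in> Y}))"
      (is "Sigma02 _ ?S")
      by (intro Sigma02_Un)
    moreover have "?S = UNIV - ?E"
      unfolding set_eq_iff mem UnCI Diff_iff all_pfst_psnd by blast
    ultimately show ?thesis using overt by (simp add: Pi02_def)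
  qed
  then show "computably_overt Pomega_basis ?E" "Pi02 Pomega Pomega_basis ?E" by auto
qed

section \<open>Constructing an effectively open map\<close>

lemma uniformly_effective_open_comp:
  assumes "uniformly_effective_open B U" "computable h"
  shows "uniformly_effective_open B (\<lambda>n. U (h n))"
proof -
  obtain f where "computable f" "\<And>n. U n = (\<Union>i\<in>W (f n). B i)"
    using assms(1) unfolding uniformly_effective_open_def by blast
  then show ?thesis
    unfolding uniformly_effective_open_def using computable_comp[OF _ assms(2), of f] by auto
qed

text \<open>From any basic set around \<open>x\<close>, the numbers \<open>n < c\<close> are visited
  in turn; at each element of the finite set the current basic set shrinks to one inside its
  intersection with \<open>B n\<close>. The list \<open>K\<close> records the indices. The free
  start also covers the empty intersection, which is the whole space.\<close>

lemma uniformly_effective_open_finite_Int: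
  assumes X: "effective_topological_space X B"
  shows "uniformly_effective_open B (\<lambda>c. {x \<in> topspace X. \<forall>n\<in>set_decode c. x \<in> B n})"
proof -
  obtain f where f: "computable f" "\<And>i j. B i \<inter> B j = (\<Union>k\<in>W (f (prod_encode (i, j))). B k)"
    using X unfolding effective_topological_space_def by blast
  define link where "link c n i k \<longleftrightarrow> n \<notin> set_decode c \<and> k = i \<or> k \<in> W (f (prod_encode (i, n)))"
    for c n i k
  define R where "R c k \<longleftrightarrow> (\<exists>K. (\<forall>n<c. link c n (lnth K n) (lnth K (Suc n))) \<and> lnth K c = k)" for c k
  have "Sigma1 (\<lambda>z. R (pfst z) (psnd z))"
    unfolding R_def link_def
    by (intro Sigma1_intros Sigma1_mem_W computable_comp[OF f(1)] computable_intros)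
  then show ?thesis
  proof (rule uniformly_effective_openI)
    fix c x
    show "x \<in> {x \<in> topspace X. \<forall>n\<in>set_decode c. x \<in> B n} \<longleftrightarrow> (\<exists>k. R c k \<and> x \<in> B k)"
    proof
      assume x: "x \<in> {x \<in> topspace X. \<forall>n\<in>set_decode c. x \<in> B n}"
      have "\<exists>\<kappa>. \<forall>n. x \<in> B (\<kappa> n) \<and> link c n (\<kappa> n) (\<kappa> (Suc n))"
      proof (rule dependent_nat_choice)
        show "\<exists>i. x \<in> B i" using x basis_cover[OF X] by blast
        fix i n assume "x \<in> B i"
        then show "\<exists>k. x \<in> B k \<and> link c n i k"
          using x f(2)[of i n] unfolding link_def by (cases "n \<in> set_decode c") blast+
      qed
      then obtain \<kappa> where \<kappa>: "\<And>n. x \<in> B (\<kappa> n)" "\<And>n. link c n (\<kappa> n) (\<kappa> (Suc n))" by blast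
      define K where "K = list_encode (map \<kappa> [0..<Suc c])"
      have K: "lnth K n = \<kappa> n" if "n \<le> c" for n
        using that unfolding K_def by (subst lnth_list_encode) (auto simp del: upt_Suc)
      have "R c (\<kappa> c)" unfolding R_def using \<kappa>(2) by (intro exI[of _ K]) (simp add: K)
      then show "\<exists>k. R c k \<and> x \<in> B k" using \<kappa>(1) by blast
    next
      assume "\<exists>k. R c k \<and> x \<in> B k"
      then obtain K where K: "\<And>n. n < c \<Longrightarrow> link c n (lnth K n) (lnth K (Suc n))" "x \<in> B (lnth K c)"
        unfolding R_def by blast
      \<comment> \<open>Each basic set of the chain lies in its predecessor, so membership passes
        from the last one back to all others.\<close>
      have step: "x \<in> B (lnth K n)" if "n < c" "x \<in> B (lnth K (Suc n))" for n
        using K(1)[OF that(1)] that(2) f(2)[of "lnth K n" n] unfolding link_def by auto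
      have all: "x \<in> B (lnth K n)" if "n \<le> c" for n
        using that by (induction rule: inc_induct) (auto intro: K(2) step)
      have "x \<in> B n" if "n \<in> set_decode c" for n
        using K(1)[of n] all[of "Suc n"] mem_set_decode_less[OF that] that f(2)[of "lnth K n" n]
        unfolding link_def by auto
      then show "x \<in> {x \<in> topspace X. \<forall>n\<in>set_decode c. x \<in> B n}"
        using K(2) basis_subset[OF X] by blast
    qed
  qed
qed

text \<open>
  A state \<open>z\<close> codes a pair \<open>(k, c)\<close>: the next task and the finite set approximating the limit.
  Task \<open>k = (r, ((n, i), s))\<close> asks for entering \<open>V n\<close> if \<open>s\<close> witnesses that the \<open>i\<close>-th basic set is
  part of \<open>U n\<close> and the approximation is already in that basic set; \<open>r\<close> makes every task recur.
\<close>

definition admissible ::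
    "nat set set \<Rightarrow> (nat \<Rightarrow> nat) \<Rightarrow> (nat \<Rightarrow> nat \<Rightarrow> bool) \<Rightarrow> nat \<Rightarrow> nat \<Rightarrow> bool" where
  "admissible E D RV z c' \<longleftrightarrow>
     (\<forall>a\<in>set_decode (psnd z). a \<in> set_decode c') \<and> Pomega_basis c' \<inter> E \<noteq> {} \<and>
     (0 < D (psnd (pfst z)) \<or>
      (\<exists>a. a \<in> set_decode (psnd (pfst (psnd (pfst z)))) \<and> a \<notin> set_decode (psnd z)) \<or>
      (\<exists>j. RV (pfst (pfst (psnd (pfst z)))) j \<and> (\<forall>a\<in>set_decode j. a \<in> set_decode c')))"

text \<open>
  The input digit \<open>m\<close> proposes a successor. If it is not accepted, the first component of the clock \<open>j\<close>
  is tried instead; as it takes every value infinitely often, no input can block the run forever.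
\<close>

definition run_step :: "(nat \<Rightarrow> nat \<Rightarrow> nat) \<Rightarrow> nat \<Rightarrow> nat \<Rightarrow> nat \<Rightarrow> nat" where
  "run_step G j z m =
     (if G z m = 0 then prod_encode (Suc (pfst z), pfst m)
      else if G z (pfst j) = 0 then prod_encode (Suc (pfst z), pfst (pfst j)) else z)"

definition run :: "(nat \<Rightarrow> nat \<Rightarrow> nat) \<Rightarrow> (nat \<Rightarrow> nat) \<Rightarrow> nat \<Rightarrow> nat" where
  "run G p j = rec_nat (prod_encode (0, 0)) (\<lambda>j z. run_step G j z (p j)) j"

lemma run_0 [simp]: "run G p 0 = prod_encode (0, 0)"
  and run_Suc [simp]: "run G p (Suc j) = run_step G j (run G p j) (p j)"
  by (simp_all add: run_def)

lemma run_cong: "(\<And>i. i < j \<Longrightarrow> p i = q i) \<Longrightarrow> run G p j = run G q j"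
  by (induction j) auto

lemma computable_run:
  assumes G: "computable (\<lambda>z. G (pfst z) (psnd z))"
  shows "computable (\<lambda>s. run G (lnth s) (llen s))"
proof -
  have G': "computable (\<lambda>x. G (f x) (g x))" if "computable f" "computable g" for f g
    using computable_comp[OF G computable_prod_encode[OF that]] by simp
  show ?thesis
    unfolding run_def run_step_def by (intro computable_rec_nat computable_intros G')
qed

text \<open>\<open>D\<close> and \<open>G\<close> check witnesses, of \<open>RU\<close> and of
  admissibility. An accepted digit is a proposed finite set together with a witness of its
  admissibility, so every step of the run is decidable.\<close>

locale overt_Pi02 =
  fixes E :: "nat set set" and D :: "nat \<Rightarrow> nat" and RU RV :: "nat \<Rightarrow> nat \<Rightarrow> bool"
    and G :: "nat \<Rightarrow> nat \<Rightarrow> nat"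
  assumes nonempty: "E \<noteq> {}"
    and E_iff: "\<And>Y. Y \<in> E \<longleftrightarrow> (\<forall>n. (\<exists>i. RU n i \<and> Y \<in> Pomega_basis i) \<longrightarrow> (\<exists>j. RV n j \<and> Y \<in> Pomega_basis j))"
    and D: "\<And>n i. RU n i \<longleftrightarrow> (\<exists>s. D (prod_encode (prod_encode (n, i), s)) = 0)"
    and G: "\<And>z c. admissible E D RV z c \<longleftrightarrow> (\<exists>w. G z (prod_encode (c, w)) = 0)"
begin

abbreviation approx :: "(nat \<Rightarrow> nat) \<Rightarrow> nat \<Rightarrow> nat set" where
  "approx p j \<equiv> set_decode (psnd (run G p j))"

definition limit :: "(nat \<Rightarrow> nat) \<Rightarrow> nat set" where
  "limit p = (\<Union>j. approx p j)"

lemma G_admissible: "G z m = 0 \<Longrightarrow> admissible E D RV z (pfst m)"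
  using G[of z "pfst m"] by (metis prod_encode_pfst_psnd)

lemma run_step_cases:
  obtains (stay) "run G p (Suc j) = run G p j"
  | (advance) c where "admissible E D RV (run G p j) c"
      "run G p (Suc j) = prod_encode (Suc (pfst (run G p j)), c)"
proof (cases "G (run G p j) (p j) = 0")
  case True
  then show thesis using advance[OF G_admissible[OF True]] by (simp add: run_step_def)
next
  case no: False
  show thesis
  proof (cases "G (run G p j) (pfst j) = 0")
    case True
    then show thesis using advance[OF G_admissible[OF True]] no by (simp add: run_step_def)
  next
    case False
    then show thesis using stay no by (simp add: run_step_def)
  qed
qed

lemma approx_mono: "j \<le> j' \<Longrightarrow> approx p j \<subseteq> approx p j'"
proof (induction rule: dec_induct)
  case (step n)
  have "approx p n \<subseteq> approx p (Suc n)"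
    by (rule run_step_cases[of p n]) (auto simp: admissible_def)
  with step show ?case by blast
qed simp

lemma run_meets: "Pomega_basis (psnd (run G p j)) \<inter> E \<noteq> {}"
proof (induction j)
  case 0 show ?case using nonempty by (auto simp: Pomega_basis_def)
next
  case (Suc j)
  show ?case by (rule run_step_cases[of p j]) (use Suc in \<open>auto simp: admissible_def\<close>)
qed

text \<open>Any \<open>Y \<in> E\<close> above the current set can guide the next step: if the task
  is pending, \<open>Y\<close> satisfies the \<open>RU\<close> side, hence the \<open>RV\<close>
  side, and a finite part of \<open>Y\<close> shows it. Adding the elements of \<open>Y\<close>
  below the counter lets such steps exhaust \<open>Y\<close>.\<close>

lemma admissible_within:
  assumes Y: "Y \<in> E" "set_decode (psnd z) \<subseteq> Y"
  shows "\<exists>c. admissible E D RV z c \<and> set_decode c \<subseteq> Y \<and> {x \<in> Y. x < pfst z} \<subseteq> set_decode c"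
proof -
  let ?q = "psnd (pfst z)"
  let ?task = "D ?q = 0 \<and> set_decode (psnd (pfst ?q)) \<subseteq> set_decode (psnd z)"
  have "\<exists>j. set_decode j \<subseteq> Y \<and> (?task \<longrightarrow> RV (pfst (pfst ?q)) j)"
  proof (cases ?task)
    case True
    then have "RU (pfst (pfst ?q)) (psnd (pfst ?q))"
      unfolding D by (intro exI[of _ "psnd ?q"]) simp
    moreover have "Y \<in> Pomega_basis (psnd (pfst ?q))" using True Y(2) by (auto simp: Pomega_basis_def)
    ultimately show ?thesis using E_iff Y(1) unfolding Pomega_basis_def by blast
  next
    case False
    \<comment> \<open>Index 0 is the empty set; without a pending task nothing has to be
      entered.\<close>
    then show ?thesis by (intro exI[of _ 0]) auto
  qed
  then obtain j where j: "set_decode j \<subseteq> Y" "?task \<longrightarrow> RV (pfst (pfst ?q)) j" by blast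
  obtain c where c: "set_decode c = set_decode (psnd z) \<union> set_decode j \<union> {x \<in> Y. x < pfst z}"
    using set_decode_surj[of "set_decode (psnd z) \<union> set_decode j \<union> {x \<in> Y. x < pfst z}"] by auto
  have "Y \<in> Pomega_basis c" using c j(1) Y(2) by (auto simp: Pomega_basis_def)
  then have "admissible E D RV z c"
    unfolding admissible_def using c j(2) Y(1) zero_less_iff_neq_zero[of "D ?q"] by blast
  moreover have "set_decode c \<subseteq> Y" using c j(1) Y(2) by auto
  ultimately show ?thesis using c by blast
qed

text \<open>Were the run stuck from step \<open>j\<close> on, its set would still have an admissible
  successor, and the clock would offer that successor at a later step.\<close>

lemma run_advances:
  "\<exists>j'\<ge>j. run G p j' = run G p j \<and>
     (\<exists>c. admissible E D RV (run G p j) c \<and> run G p (Suc j') = prod_encode (Suc (pfst (run G p j)), c))"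
proof (rule ccontr)
  assume stuck: "\<not> ?thesis"
  have const: "run G p j' = run G p j" if "j \<le> j'" for j'
    using that
  proof (induction rule: dec_induct)
    case (step n)
    show ?case by (rule run_step_cases[of p n]) (use step stuck in auto)
  qed simp
  obtain Y where "Y \<in> E" "set_decode (psnd (run G p j)) \<subseteq> Y"
    using run_meets[of p j] by (auto simp: Pomega_basis_def)
  then obtain m where m: "G (run G p j) m = 0"
    using admissible_within G by blast
  \<comment> \<open>A clock value not before \<open>j\<close> whose first component is the proposal
    \<open>m\<close>.\<close>
  let ?j = "prod_encode (m, j)"
  have "j \<le> ?j" by (rule le_prod_encode_2)
  have "pfst (run G p (Suc ?j)) = Suc (pfst (run G p j))"
    using m const[OF \<open>j \<le> ?j\<close>] by (simp add: run_step_def)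
  then show False using const[of "Suc ?j"] \<open>j \<le> ?j\<close> by simp
qed

lemma run_reaches:
  "\<exists>j c. pfst (run G p j) = k \<and> admissible E D RV (run G p j) c \<and> run G p (Suc j) = prod_encode (Suc k, c)"
proof (induction k)
  case 0
  show ?case using run_advances[of 0 p] by (metis pfst_prod_encode run_0)
next
  case (Suc k)
  then obtain j where "pfst (run G p (Suc j)) = Suc k" by (metis pfst_prod_encode)
  then show ?case using run_advances[of "Suc j" p] by metis
qed

text \<open>That the limit lies in a basic set is visible from some finite step \<open>N\<close> on;
  a task for this basic set handled at \<open>N\<close> or later must enter the matching
  \<open>RV\<close> set.\<close>

lemma limit_mem: "limit p \<in> E"
  unfolding E_iff
proof (intro allI impI, elim exE conjE)
  fix n i assume "RU n i" and i: "limit p \<in> Pomega_basis i"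
  then obtain s where s: "D (prod_encode (prod_encode (n, i), s)) = 0" using D by blast
  have "\<forall>a\<in>set_decode i. \<exists>j. a \<in> approx p j" using i by (auto simp: Pomega_basis_def limit_def)
  then obtain h where h: "\<And>a. a \<in> set_decode i \<Longrightarrow> a \<in> approx p (h a)" by metis
  obtain N where N: "\<And>a. a \<in> set_decode i \<Longrightarrow> h a < N"
    using finite_nat_bounded[of "h ` set_decode i"] by auto
  have iN: "set_decode i \<subseteq> approx p N" using h N approx_mono by (meson less_imp_le subset_iff)
  have slow: "pfst (run G p j) \<le> j" for j
  proof (induction j)
    case (Suc j) show ?case by (rule run_step_cases[of p j]) (use Suc in auto)
  qed simp
  \<comment> \<open>The counter grows by at most one per step, so a task number that is at least
    \<open>N\<close> comes up at step \<open>N\<close> or later. The first component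
    \<open>N\<close> makes the number that large.\<close>
  let ?k = "prod_encode (N, prod_encode (prod_encode (n, i), s))"
  obtain j c where j: "pfst (run G p j) = ?k" "admissible E D RV (run G p j) c"
    "run G p (Suc j) = prod_encode (Suc ?k, c)" using run_reaches by blast
  have "N \<le> j" using slow[of j] j(1) le_prod_encode_1[of N] by (metis order_trans)
  then have "set_decode i \<subseteq> approx p j" using iN approx_mono by blast
  then obtain b where b: "RV n b" "\<forall>a\<in>set_decode b. a \<in> set_decode c"
    using j(2) s unfolding admissible_def j(1) by auto
  have "set_decode c \<subseteq> limit p" unfolding limit_def using j(3) UN_upper[of "Suc j" UNIV "approx p"] by simp
  then have "limit p \<in> Pomega_basis b" using b(2) by (auto simp: Pomega_basis_def)
  then show "\<exists>j. RV n j \<and> limit p \<in> Pomega_basis j" using b(1) by blast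
qed

text \<open>The word determines the run over its length and later sets only grow, which bounds the
  image. Every \<open>Y \<in> E\<close> above the set reached is attained by continuing the word
  with good proposals inside \<open>Y\<close>.\<close>

lemma limit_cylinder:
  "limit ` cylinder (list_decode s) = {Y \<in> E. set_decode (psnd (run G (lnth s) (llen s))) \<subseteq> Y}"
proof (intro equalityI subsetI)
  fix Y assume "Y \<in> limit ` cylinder (list_decode s)"
  then obtain p where p: "p \<in> cylinder (list_decode s)" "Y = limit p" by blast
  have "run G p (llen s) = run G (lnth s) (llen s)"
    using p(1) by (intro run_cong) (simp add: cylinder_def length_list_decode nth_list_decode)
  then show "Y \<in> {Y \<in> E. set_decode (psnd (run G (lnth s) (llen s))) \<subseteq> Y}"
    using limit_mem[of p] p(2) unfolding limit_def by (metis (mono_tags, lifting) UN_upper UNIV_I mem_Collect_eq)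
next
  fix Y assume "Y \<in> {Y \<in> E. set_decode (psnd (run G (lnth s) (llen s))) \<subseteq> Y}"
  then have Y: "Y \<in> E" "set_decode (psnd (run G (lnth s) (llen s))) \<subseteq> Y" by auto
  define good where "good z m \<longleftrightarrow> G z m = 0 \<and> set_decode (pfst m) \<subseteq> Y \<and>
      {x \<in> Y. x < pfst z} \<subseteq> set_decode (pfst m)" for z m
  have good: "good z (SOME m. good z m)" if z: "set_decode (psnd z) \<subseteq> Y" for z
  proof (rule someI_ex)
    obtain c where "admissible E D RV z c" "set_decode c \<subseteq> Y" "{x \<in> Y. x < pfst z} \<subseteq> set_decode c"
      using admissible_within[OF Y(1) z] by blast
    then show "\<exists>m. good z m" unfolding good_def G by (metis pfst_prod_encode)
  qed
  \<comment> \<open>The next digit depends on the current state, so the states are generated first,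
    as \<open>S\<close>, and the input \<open>p\<close> is read off from them.\<close>
  define digit where "digit j z = (if j < llen s then lnth s j else SOME m. good z m)" for j z
  define S where "S = rec_nat (prod_encode (0, 0)) (\<lambda>j z. run_step G j z (digit j z))"
  define p where "p j = digit j (S j)" for j
  have S: "run G p j = S j" for j by (induction j) (auto simp: S_def p_def)
  have p_good: "good (run G p j) (p j)" if "llen s \<le> j" "approx p j \<subseteq> Y" for j
    using good[OF that(2)] that(1) unfolding S by (simp add: p_def digit_def)
  have p: "p \<in> cylinder (list_decode s)"
    by (simp add: cylinder_def length_list_decode nth_list_decode p_def digit_def)
  have init: "run G p (llen s) = run G (lnth s) (llen s)"
    by (rule run_cong) (simp add: p_def digit_def)
  \<comment> \<open>Good digits are accepted at once, so the counter rises at every step after the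
    word.\<close>
  have step: "approx p (llen s + d) \<subseteq> Y \<and> d \<le> pfst (run G p (llen s + d))" for d
  proof (induction d)
    case 0 show ?case using Y(2) init by simp
  next
    case (Suc d)
    then have "good (run G p (llen s + d)) (p (llen s + d))"
      by (intro p_good) auto
    then show ?case using Suc by (simp add: run_step_def good_def)
  qed
  \<comment> \<open>After \<open>Suc x\<close> further steps the counter exceeds \<open>x\<close>;
    the digit read then puts \<open>x\<close> into the set, which shows one step later.\<close>
  have catch: "x \<in> approx p (llen s + Suc (Suc x))" if "x \<in> Y" for x
  proof -
    have "good (run G p (llen s + Suc x)) (p (llen s + Suc x))"
      using step[of "Suc x"] by (intro p_good) auto
    moreover have "x < pfst (run G p (llen s + Suc x))" using step[of "Suc x"] by simp
    ultimately show ?thesis using that by (auto simp: run_step_def good_def)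
  qed
  have "limit p = Y"
  proof (intro equalityI subsetI)
    fix x assume "x \<in> limit p"
    then obtain j where "x \<in> approx p j" by (auto simp: limit_def)
    then show "x \<in> Y" using approx_mono[of j "llen s + j" p] step[of j] by auto
  next
    fix x assume "x \<in> Y"
    then show "x \<in> limit p" unfolding limit_def using catch by blast
  qed
  then show "Y \<in> limit ` cylinder (list_decode s)" using p by blast
qed

end

section \<open>The effectively open surjection given by the limits of runs\<close>

lemma overt_Pi02_imp_effective_quasi_Polish:
  assumes X: "effective_topological_space X B"
    and overt: "computably_overt Pomega_basis (canonical_embedding B ` topspace X)"
    and Pi02: "Pi02 Pomega Pomega_basis (canonical_embedding B ` topspace X)"
  shows "effective_quasi_Polish X B"
proof (cases "topspace X = {}")
  case True then show ?thesis by (simp add: effective_quasi_Polish_def)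
next
  case False
  define E where "E = canonical_embedding B ` topspace X"
  have S: "Sigma1 (\<lambda>i. Pomega_basis i \<inter> E \<noteq> {})"
    using overt unfolding computably_overt_def ce_iff_Sigma1 E_def by simp
  obtain U V where UV: "uniformly_effective_open Pomega_basis U" "uniformly_effective_open Pomega_basis V"
    and E: "UNIV - E = (\<Union>n. U n - V n)"
    using Pi02 unfolding Pi02_def Sigma02_def E_def by auto
  obtain RU where RU: "\<And>f g. computable f \<Longrightarrow> computable g \<Longrightarrow> Sigma1 (\<lambda>x. RU (f x) (g x))"
      "\<And>n x. x \<in> U n \<longleftrightarrow> (\<exists>i. RU n i \<and> x \<in> Pomega_basis i)"
    using UV(1) by (rule uniformly_effective_openE) blast
  obtain RV where RV: "\<And>f g. computable f \<Longrightarrow> computable g \<Longrightarrow> Sigma1 (\<lambda>x. RV (f x) (g x))"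
      "\<And>n x. x \<in> V n \<longleftrightarrow> (\<exists>i. RV n i \<and> x \<in> Pomega_basis i)"
    using UV(2) by (rule uniformly_effective_openE) blast
  obtain D where D: "computable D"
    "\<And>z. RU (pfst z) (psnd z) \<longleftrightarrow> (\<exists>s. D (prod_encode (z, s)) = 0)"
    using RU(1)[OF computable_pfst[OF computable_id] computable_psnd[OF computable_id]]
    by (rule Sigma1E) blast
  have "Sigma1 (\<lambda>z. admissible E D RV (pfst z) (psnd z))"
    unfolding admissible_def
    by (intro Sigma1_intros Sigma1_set_intros Sigma1_subst[OF S] RV(1) computable_comp[OF D(1)]
        computable_intros)
  then obtain G where G: "computable G"
    "\<And>z. admissible E D RV (pfst z) (psnd z) \<longleftrightarrow> (\<exists>w. G (prod_encode (z, w)) = 0)"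
    by (rule Sigma1E) blast
  \<comment> \<open>Regroups the pairs so that one digit holds the proposal and its witness.\<close>
  define G' where "G' z m = G (prod_encode (prod_encode (z, pfst m), psnd m))" for z m
  have cG': "computable (\<lambda>z. G' (pfst z) (psnd z))"
    unfolding G'_def by (intro computable_comp[OF G(1)] computable_intros)
  interpret overt_Pi02 E D RU RV G'
  proof
    show "E \<noteq> {}" using False by (simp add: E_def)
    show "Y \<in> E \<longleftrightarrow> (\<forall>n. (\<exists>i. RU n i \<and> Y \<in> Pomega_basis i) \<longrightarrow> (\<exists>j. RV n j \<and> Y \<in> Pomega_basis j))" for Y
      using E unfolding set_eq_iff RU(2)[symmetric] RV(2)[symmetric] by blast
    show "RU n i \<longleftrightarrow> (\<exists>s. D (prod_encode (prod_encode (n, i), s)) = 0)" for n i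
      using D(2)[of "prod_encode (n, i)"] by simp
    show "admissible E D RV z c \<longleftrightarrow> (\<exists>w. G' z (prod_encode (c, w)) = 0)" for z c
      using G(2)[of "prod_encode (z, c)"] by (simp add: G'_def)
  qed
  \<comment> \<open>\<open>c s\<close> codes the finite set reached after the word \<open>s\<close>;
    it describes both the images of cylinders and the preimages of basic sets.\<close>
  define c where "c s = psnd (run G' (lnth s) (llen s))" for s
  have c: "computable c"
    unfolding c_def by (intro computable_psnd computable_run cG')
  define f where "f p = the_inv_into (topspace X) (canonical_embedding B) (limit p)" for p
  note inj = inj_canonical_embedding[OF X]
  have f: "f p \<in> topspace X" "canonical_embedding B (f p) = limit p" for p
    using limit_mem[of p] the_inv_into_into[OF inj _ subset_refl] f_the_inv_into_f[OF inj]
    unfolding E_def f_def by auto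
  have image: "f ` cylinder (list_decode s) = {x \<in> topspace X. \<forall>n\<in>set_decode (c s). x \<in> B n}" for s
  proof (intro equalityI subsetI)
    fix x assume "x \<in> f ` cylinder (list_decode s)"
    then obtain p where p: "x = f p" "p \<in> cylinder (list_decode s)" by blast
    then have "set_decode (c s) \<subseteq> canonical_embedding B x"
      using limit_cylinder[of s] f(2) unfolding c_def by blast
    then show "x \<in> {x \<in> topspace X. \<forall>n\<in>set_decode (c s). x \<in> B n}"
      using f(1) p(1) by (auto simp: canonical_embedding_def)
  next
    fix x assume x: "x \<in> {x \<in> topspace X. \<forall>n\<in>set_decode (c s). x \<in> B n}"
    then have "canonical_embedding B x \<in> {Y \<in> E. set_decode (c s) \<subseteq> Y}"
      by (auto simp: E_def canonical_embedding_def)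
    then obtain p where p: "p \<in> cylinder (list_decode s)" "limit p = canonical_embedding B x"
      using limit_cylinder[of s] unfolding c_def by (metis (no_types, lifting) imageE)
    then have "f p = x" using f x inj by (metis (no_types, lifting) inj_onD mem_Collect_eq)
    then show "x \<in> f ` cylinder (list_decode s)" using p(1) by blast
  qed
  have "range f = topspace X"
    \<comment> \<open>Code 0 is the empty word, after which the run has reached only the empty
      set.\<close>
    using image[of 0] llen_list_encode[of "[]"] by (simp add: cylinder_def c_def)
  moreover have "effectively_open_map B f"
    unfolding effectively_open_map_def
  proof (intro exI conjI allI)
    show "uniformly_effective_open B (\<lambda>s. {x \<in> topspace X. \<forall>n\<in>set_decode (c s). x \<in> B n})"
      by (rule uniformly_effective_open_comp[OF uniformly_effective_open_finite_Int[OF X] c])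
    show "f ` cylinder \<sigma> = {x \<in> topspace X. \<forall>n\<in>set_decode (c (list_encode \<sigma>)). x \<in> B n}" for \<sigma>
      using image[of "list_encode \<sigma>"] by simp
  qed
  moreover have "computable_map Baire Baire_basis X B f"
    unfolding computable_map_def
  proof
    show "f \<in> topspace Baire \<rightarrow> topspace X" using f(1) by simp
    show "uniformly_effective_open Baire_basis (\<lambda>n. {p \<in> topspace Baire. f p \<in> B n})"
    proof (rule uniformly_effective_openI)
      show "Sigma1 (\<lambda>z. pfst z \<in> set_decode (c (psnd z)))"
        by (intro Sigma1_intros computable_comp[OF c] computable_intros)
      fix n p
      have run: "run G' p (llen s) = run G' (lnth s) (llen s)" if "p \<in> Baire_basis s" for s
        using that by (intro run_cong) (simp add: Baire_basis_def cylinder_def length_list_decode nth_list_decode)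
      have "f p \<in> B n \<longleftrightarrow> n \<in> limit p" using f(2)[of p] by (auto simp: canonical_embedding_def)
      \<comment> \<open>A number enters the limit at a finite stage, which a prefix of
        \<open>p\<close> determines.\<close>
      also have "\<dots> \<longleftrightarrow> (\<exists>s. n \<in> set_decode (c s) \<and> p \<in> Baire_basis s)"
      proof
        assume "n \<in> limit p"
        then obtain j where j: "n \<in> approx p j" by (auto simp: limit_def)
        let ?s = "list_encode (map p [0..<j])"
        have s: "p \<in> Baire_basis ?s" by (simp add: Baire_basis_def mem_cylinder_map)
        have "llen ?s = j" by (simp add: llen_list_encode)
        then have "n \<in> set_decode (c ?s)" using j run[OF s] by (simp add: c_def)
        then show "\<exists>s. n \<in> set_decode (c s) \<and> p \<in> Baire_basis s" using s by blast
      next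
        assume "\<exists>s. n \<in> set_decode (c s) \<and> p \<in> Baire_basis s"
        then show "n \<in> limit p" unfolding limit_def c_def using run by (metis UN_I UNIV_I)
      qed
      finally show "p \<in> {p \<in> topspace Baire. f p \<in> B n} \<longleftrightarrow>
          (\<exists>s. n \<in> set_decode (c s) \<and> p \<in> Baire_basis s)" by simp
    qed
  qed
  ultimately show ?thesis unfolding effective_quasi_Polish_def by auto
qed

theorem theorem1:
  fixes X :: "'a topology" and B :: "nat \<Rightarrow> 'a set"
  assumes "effective_topological_space X B"
  shows "(effective_quasi_Polish X B \<longleftrightarrow>
            computably_overt Pomega_basis (canonical_embedding B ` topspace X) \<and>
            Pi02 Pomega Pomega_basis (canonical_embedding B ` topspace X)) \<and>
         (computably_overt Pomega_basis (canonical_embedding B ` topspace X) \<and>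
            Pi02 Pomega Pomega_basis (canonical_embedding B ` topspace X) \<longleftrightarrow>
          computably_overt Baire_basis (dom (standard_representation X B)) \<and>
            Pi02 Baire Baire_basis (dom (standard_representation X B)))"
  \<comment> \<open>The domain becomes the \<open>\<rho>\<close>-preimage of the embedded space and
    the two overtness conditions become identical; what remains between (2) and (3) is the transfer
    of \<open>Pi02\<close>.\<close>
  unfolding dom_standard_representation computably_overt_rho
  using effective_quasi_Polish_imp_overt_Pi02[OF assms]
    overt_Pi02_imp_effective_quasi_Polish[OF assms] Pi02_vimage_rho Pi02_if_vimage_rho by blast

end
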